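(* Let $Q_0\subset\mathbb{R}^n$ be a cube. If $f\in \mathrm{VMO}(Q_0)$, then its decreasing rearrangement satisfies $f^*\in\mathrm{VMO}(0,|Q_0|)$.
   Context: Cubes are open, of finite side length, with sides parallel to the coordinate axes; $|\cdot|$ is Lebesgue measure. For a set $S$ with $0<|S|<\infty$ and real-valued $f\in L^1(S)$, put $f_S=\frac1{|S|}\int_S f$ and $\mathcal{O}(f,S)=\frac1{|S|}\int_S|f-f_S|$ (mean oscillation). $\mathrm{BMO}(Q_0)$ is the set of real-valued $f$ with $f\in L^1(Q)$ for every cube $Q\subset Q_0$ (including $Q=Q_0$) and $\|f\|_{\mathrm{BMO}}:=\sup_{Q\subset Q_0}\mathcal{O}(f,Q)<\infty$. $\mathrm{VMO}(Q_0)$ is the set of $f\in\mathrm{BMO}(Q_0)$ with $\lim_{\delta\to0^+}\sup\{\mathcal{O}(f,Q): Q\subset Q_0 \text{ a cube},\ |Q|\le\delta\}=0$. For an open interval $I\subset\mathbb{R}$, $\mathrm{BMO}(I)$ and $\mathrm{VMO}(I)$ are defined in the same way using all finite open subintervals $J\subset I$ (not required to be compactly contained in $I$) in place of cubes. For a measurable function $f$ on $Q_0$, the distribution function is $\mu_f(\alpha)=|\{x\in Q_0:|f(x)|>\alpha\}|$, $\alpha\ge0$, and the decreasing rearrangement is $f^*(s)=|\{\alpha\ge0:\mu_f(\alpha)>s\}|$ for $s\in(0,|Q_0|)$. (Functions are not identified modulo constants.) *)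

theory Defs
  imports "HOL-Analysis.Analysis"
begin

definition is_cube :: "'a::euclidean_space set \<Rightarrow> bool" where
  "is_cube Q \<longleftrightarrow> (\<exists>a r. 0 < r \<and> Q = box a (a + r *\<^sub>R One))"

lemma is_cube_cart:
  fixes Q :: "(real ^ 'n) set"
  shows "is_cube Q \<longleftrightarrow> (\<exists>a r. 0 < r \<and> Q = {x. \<forall>i. a $ i < x $ i \<and> x $ i < a $ i + r})"
proof -
  have "box a (a + r *\<^sub>R One) = {x. \<forall>i. a $ i < x $ i \<and> x $ i < a $ i + r}"
    for a :: "real ^ 'n" and r
  proof -
    have "(One :: real ^ 'n) $ i = 1" for i
      by (simp add: cart_eq_inner_axis inner_sum_left_Basis axis_in_Basis_iff del: inner_axis)
    then show ?thesis by (auto simp: mem_box_cart)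
  qed
  then show ?thesis by (simp add: is_cube_def)
qed

text \<open>On the real line the cubes are the nonempty bounded open intervals, so that the
  definitions below cover both functions on a cube and functions on an interval.\<close>

lemma is_cube_real:
  fixes J :: "real set"
  shows "is_cube J \<longleftrightarrow> (\<exists>a b. a < b \<and> J = {a<..<b})"
proof
  assume "is_cube J"
  then obtain a r where "0 < r" "J = {a<..<a + r}" by (auto simp: is_cube_def box_real)
  then show "\<exists>a b. a < b \<and> J = {a<..<b}" by (intro exI[of _ a] exI[of _ "a + r"]) simp
next
  assume "\<exists>a b. a < b \<and> J = {a<..<b}"
  then obtain a b where "a < b" "J = {a<..<b}" by blast
  then show "is_cube J"
    unfolding is_cube_def by (intro exI[of _ a] exI[of _ "b - a"]) (simp add: box_real)
qed

definition mean_value :: "('a::euclidean_space \<Rightarrow> real) \<Rightarrow> 'a set \<Rightarrow> real" where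
  "mean_value f S = (1 / measure lebesgue S) * (LINT x:S|lebesgue. f x)"

definition mean_oscillation :: "('a::euclidean_space \<Rightarrow> real) \<Rightarrow> 'a set \<Rightarrow> real" where
  "mean_oscillation f S =
     (1 / measure lebesgue S) * (LINT x:S|lebesgue. \<bar>f x - mean_value f S\<bar>)"

text \<open>Functions on \<open>S\<close> are represented by total functions; only their values on \<open>S\<close> are
  used. The suprema are taken in the extended nonnegative reals.\<close>

definition BMO_norm :: "'a::euclidean_space set \<Rightarrow> ('a \<Rightarrow> real) \<Rightarrow> ennreal" where
  "BMO_norm S f = (SUP Q\<in>{Q. is_cube Q \<and> Q \<subseteq> S}. ennreal (mean_oscillation f Q))"

definition BMO :: "'a::euclidean_space set \<Rightarrow> ('a \<Rightarrow> real) set" where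
  "BMO S = {f. (\<forall>Q. is_cube Q \<and> Q \<subseteq> S \<longrightarrow> set_integrable lebesgue Q f) \<and> BMO_norm S f < \<infinity>}"

definition VMO_modulus :: "'a::euclidean_space set \<Rightarrow> ('a \<Rightarrow> real) \<Rightarrow> real \<Rightarrow> ennreal" where
  "VMO_modulus S f \<delta> =
     (SUP Q\<in>{Q. is_cube Q \<and> Q \<subseteq> S \<and> measure lebesgue Q \<le> \<delta>}. ennreal (mean_oscillation f Q))"

definition VMO :: "'a::euclidean_space set \<Rightarrow> ('a \<Rightarrow> real) set" where
  "VMO S = {f \<in> BMO S. (VMO_modulus S f \<longlongrightarrow> 0) (at_right 0)}"

definition distribution_function :: "'a::euclidean_space set \<Rightarrow> ('a \<Rightarrow> real) \<Rightarrow> real \<Rightarrow> real" where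
  "distribution_function S f \<alpha> = measure lebesgue {x \<in> S. \<bar>f x\<bar> > \<alpha>}"

text \<open>For \<open>S\<close> of finite measure, \<open>f\<close> measurable on \<open>S\<close> and \<open>s > 0\<close>, the set below is a bounded
  interval, so its real-valued \<^const>\<open>measure\<close> is its Lebesgue measure. Values at other \<open>s\<close> are
  irrelevant.\<close>

definition decreasing_rearrangement ::
    "'a::euclidean_space set \<Rightarrow> ('a \<Rightarrow> real) \<Rightarrow> real \<Rightarrow> real" where
  "decreasing_rearrangement S f s =
     measure lebesgue {\<alpha>. 0 \<le> \<alpha> \<and> distribution_function S f \<alpha> > s}"

end

theory Submission
  imports Defs
begin

text \<open>
  Replacing \<open>f\<close> by \<open>\<bar>f\<bar>\<close> at most doubles mean oscillations, so let \<open>g = \<bar>f\<bar>\<close> and \<open>F = f\<^sup>*\<close>. Mean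
  oscillation of the decreasing function \<open>F\<close> is controlled separately near \<open>0\<close> and away from it.

  Near \<open>0\<close>: for \<open>c = F q\<close> the level set \<open>{g > c}\<close> has measure at most \<open>q\<close>. A Calderon--Zygmund stopping
  argument covers it by cubes of comparable total measure in which it occupies at most half of the
  volume, and on such a cube the integral of \<open>(g - c)\<^sup>+\<close> is at most three times the integral of
  \<open>\<bar>g - g\<^sub>D\<bar>\<close>. The cubes have measure \<open>O(q)\<close>, so the integral of \<open>(F - F q)\<^sup>+\<close> is \<open>o(q)\<close>, and by
  monotonicity this quantity bounds the mean oscillation of \<open>F\<close> on every subinterval of \<open>(0, q)\<close>.

  Away from \<open>0\<close>: \<open>F\<close> is monotone and bounded, so it suffices that it is continuous. A jump would be
  a gap in the essential range of \<open>g\<close>, hence a level set of intermediate density \<open>t\<close> in the cube; sliding a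
  small cube, the intermediate value theorem gives arbitrarily small cubes of density exactly \<open>t\<close>, on
  which the mean oscillation is bounded below.
\<close>

subsection \<open>Cubes and dyadic subdivision\<close>

lemma inner_cube_upper [simp]:
  fixes a :: "'a::euclidean_space"
  shows "i \<in> Basis \<Longrightarrow> (a + r *\<^sub>R One) \<bullet> i = a \<bullet> i + r"
  by (simp add: inner_add_left)

lemma lebesgue_measurable_box [simp, intro]:
  fixes a b :: "'a::euclidean_space"
  shows "box a b \<in> lmeasurable" "box a b \<in> sets lebesgue"
  by (simp_all add: lmeasurable_box)

lemma measure_cube:
  fixes a :: "'a::euclidean_space"
  assumes "0 \<le> r"
  shows "measure lebesgue (box a (a + r *\<^sub>R One)) = r ^ DIM('a)"
proof -
  have "measure lebesgue (box a (a + r *\<^sub>R One)) = measure lborel (box a (a + r *\<^sub>R One))"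
    by (simp add: measure_completion)
  also have "\<dots> = (\<Prod>b\<in>(Basis::'a set). r)"
    using assms by (subst measure_lborel_box) (auto intro!: prod.cong simp: inner_diff_left inner_add_left)
  finally show ?thesis by simp
qed

text \<open>One of the 2^n dyadic children of the cube with corner \<open>a\<close> and side
  \<open>r\<close>: \<open>S\<close> is the set of coordinate directions in which the upper half is
  taken, so \<open>Pow Basis\<close> indexes the children.\<close>

definition subcube :: "'a::euclidean_space \<Rightarrow> real \<Rightarrow> 'a set \<Rightarrow> 'a set" where
  "subcube a r S = box (a + (r/2) *\<^sub>R \<Sum>S) (a + (r/2) *\<^sub>R \<Sum>S + (r/2) *\<^sub>R One)"

lemma inner_sum_subset_Basis:
  assumes "S \<subseteq> Basis" "i \<in> Basis"
  shows "(\<Sum>S :: 'a::euclidean_space) \<bullet> i = (if i \<in> S then 1 else 0)"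
proof -
  have "finite S" by (rule finite_subset[OF assms(1) finite_Basis])
  have "(\<Sum>S) \<bullet> i = (\<Sum>j\<in>S. j \<bullet> i)" by (simp add: inner_sum_left)
  also have "\<dots> = (\<Sum>j\<in>S. if j = i then 1 else 0)"
    using assms by (intro sum.cong) (auto simp: inner_Basis)
  finally show ?thesis using \<open>finite S\<close> by simp
qed

text \<open>Away from the midplanes the index of the child is forced: it collects the coordinates of
  \<open>x\<close> beyond the midpoint. Hence the children partition the cube up to the
  midplanes.\<close>

lemma mem_subcube:
  assumes "S \<subseteq> Basis" "0 < r" "\<And>i. i \<in> Basis \<Longrightarrow> x \<bullet> i \<noteq> a \<bullet> i + r/2"
  shows "x \<in> subcube a r S \<longleftrightarrow> x \<in> box a (a + r *\<^sub>R One) \<and> S = {i\<in>Basis. a \<bullet> i + r/2 < x \<bullet> i}"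
proof -
  have "x \<in> subcube a r S \<longleftrightarrow> (\<forall>i\<in>Basis. if i \<in> S then a \<bullet> i + r/2 < x \<bullet> i \<and> x \<bullet> i < a \<bullet> i + r
      else a \<bullet> i < x \<bullet> i \<and> x \<bullet> i < a \<bullet> i + r/2)"
    unfolding subcube_def mem_box
    using assms(1) by (intro ball_cong refl) (auto simp: inner_add_left inner_sum_subset_Basis)
  also have "\<dots> \<longleftrightarrow> x \<in> box a (a + r *\<^sub>R One) \<and> S = {i\<in>Basis. a \<bullet> i + r/2 < x \<bullet> i}" (is "?L = ?R")
  proof
    assume L: ?L
    have "x \<in> box a (a + r *\<^sub>R One)"
      unfolding mem_box
    proof
      fix i :: 'a assume i: "i \<in> Basis"
      with L have "if i \<in> S then a \<bullet> i + r/2 < x \<bullet> i \<and> x \<bullet> i < a \<bullet> i + r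
         else a \<bullet> i < x \<bullet> i \<and> x \<bullet> i < a \<bullet> i + r/2" by blast
      then show "a \<bullet> i < x \<bullet> i \<and> x \<bullet> i < (a + r *\<^sub>R One) \<bullet> i"
        using i \<open>0 < r\<close> by (auto split: if_splits)
    qed
    moreover have "S = {i\<in>Basis. a \<bullet> i + r/2 < x \<bullet> i}"
      using L assms(1) by (force split: if_splits)
    ultimately show ?R by blast
  next
    assume R: ?R
    show ?L
    proof
      fix i :: 'a assume i: "i \<in> Basis"
      have "a \<bullet> i < x \<bullet> i" "x \<bullet> i < a \<bullet> i + r"
        using R i by (auto simp: mem_box)
      moreover have "i \<in> S \<longleftrightarrow> a \<bullet> i + r/2 < x \<bullet> i" using R i by blast
      ultimately show "if i \<in> S then a \<bullet> i + r/2 < x \<bullet> i \<and> x \<bullet> i < a \<bullet> i + r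
         else a \<bullet> i < x \<bullet> i \<and> x \<bullet> i < a \<bullet> i + r/2" 
        using assms(3)[OF i] by auto
    qed
  qed
  finally show ?thesis .
qed

lemma subcube_subset:
  assumes "S \<subseteq> Basis" "0 < r"
  shows "subcube a r S \<subseteq> box a (a + r *\<^sub>R One)"
proof
  fix x assume x: "x \<in> subcube a r S"
  show "x \<in> box a (a + r *\<^sub>R One)"
    unfolding mem_box
  proof
    fix i :: 'a assume i: "i \<in> Basis"
    have *: "(a + (r/2) *\<^sub>R \<Sum>S) \<bullet> i < x \<bullet> i \<and> x \<bullet> i < (a + (r/2) *\<^sub>R \<Sum>S + (r/2) *\<^sub>R One) \<bullet> i"
      using x i unfolding subcube_def mem_box by blast
    have "(a + (r/2) *\<^sub>R \<Sum>S) \<bullet> i = a \<bullet> i + (r/2) * (if i \<in> S then 1 else 0)"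
      using i assms by (simp add: inner_add_left inner_sum_subset_Basis)
    then show "a \<bullet> i < x \<bullet> i \<and> x \<bullet> i < (a + r *\<^sub>R One) \<bullet> i"
      using * i assms by (auto split: if_splits)
  qed
qed

lemma sum_indicator_subcubes:
  fixes x :: "'a::euclidean_space"
  assumes "0 < r" "\<And>i. i \<in> Basis \<Longrightarrow> x \<bullet> i \<noteq> a \<bullet> i + r/2"
  shows "(\<Sum>S\<in>Pow Basis. indicator (subcube a r S) x) = (indicator (box a (a + r *\<^sub>R One)) x :: real)"
proof -
  define T where "T = {i\<in>Basis. a \<bullet> i + r/2 < x \<bullet> i}"
  have "(\<Sum>S\<in>Pow Basis. indicator (subcube a r S) x) =
    (\<Sum>S\<in>Pow Basis. if S = T then indicator (box a (a + r *\<^sub>R One)) x else (0::real))"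
    using assms by (intro sum.cong) (auto simp: indicator_def mem_subcube T_def)
  also have "\<dots> = indicator (box a (a + r *\<^sub>R One)) x"
    by (subst sum.delta) (auto simp: T_def)
  finally show ?thesis .
qed

lemma AE_not_hyperplanes:
  fixes c :: "'a::euclidean_space \<Rightarrow> real"
  shows "AE x in lebesgue. \<forall>i\<in>Basis. (x::'a) \<bullet> i \<noteq> c i"
proof (rule AE_finite_allI)
  fix i :: 'a assume "i \<in> Basis"
  then have "negligible {x. x \<bullet> i = c i}" by (rule negligible_standard_hyperplane)
  then have "{x. x \<bullet> i = c i} \<in> null_sets lebesgue" by (simp add: negligible_iff_null_sets)
  then have "AE x in lebesgue. x \<notin> {x. x \<bullet> i = c i}" by (rule AE_not_in)
  then show "AE x in lebesgue. x \<bullet> i \<noteq> c i" by simp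
qed simp

text \<open>The midplanes are null, so the pointwise identity for the indicators holds almost
  everywhere and can be integrated.\<close>

lemma set_integral_subcubes:
  fixes f :: "'a::euclidean_space \<Rightarrow> real"
  assumes "0 < r" "set_integrable lebesgue (box a (a + r *\<^sub>R One)) f"
  shows "(LINT x:box a (a + r *\<^sub>R One)|lebesgue. f x) = (\<Sum>S\<in>Pow Basis. LINT x:subcube a r S|lebesgue. f x)"
proof -
  have int: "set_integrable lebesgue (subcube a r S) f" if "S \<in> Pow Basis" for S
    using assms that subcube_subset[of S r a]
    by (intro set_integrable_subset[OF assms(2)]) (auto simp: subcube_def)
  have "(LINT x:box a (a + r *\<^sub>R One)|lebesgue. f x) =
      (LINT x|lebesgue. (\<Sum>S\<in>Pow Basis. indicator (subcube a r S) x * f x))"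
    unfolding set_lebesgue_integral_def
  proof (rule integral_cong_AE)
    show "AE x in lebesgue. indicator (box a (a + r *\<^sub>R One)) x *\<^sub>R f x =
      (\<Sum>S\<in>Pow Basis. indicator (subcube a r S) x * f x)"
      using AE_not_hyperplanes[of "\<lambda>i. a \<bullet> i + r/2"]
      by eventually_elim (simp add: sum_indicator_subcubes[OF assms(1)] flip: sum_distrib_right)
    show "(\<lambda>x. indicator (box a (a + r *\<^sub>R One)) x *\<^sub>R f x) \<in> borel_measurable lebesgue"
      using assms(2) unfolding set_integrable_def by blast
    show "(\<lambda>x. \<Sum>S\<in>Pow Basis. indicator (subcube a r S) x * f x) \<in> borel_measurable lebesgue"
      using int unfolding set_integrable_def by (intro borel_measurable_sum) (auto dest: borel_measurable_integrable)
  qed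
  also have "\<dots> = (\<Sum>S\<in>Pow Basis. LINT x:subcube a r S|lebesgue. f x)"
    unfolding set_lebesgue_integral_def real_scaleR_def
    using int unfolding set_integrable_def by (intro Bochner_Integration.integral_sum) auto
  finally show ?thesis .
qed

lemma measure_Int_subcubes:
  fixes V :: "'a::euclidean_space set"
  assumes "0 < r" "V \<in> sets lebesgue"
  shows "measure lebesgue (V \<inter> box a (a + r *\<^sub>R One)) = (\<Sum>S\<in>Pow Basis. measure lebesgue (V \<inter> subcube a r S))"
proof -
  have ind: "indicator A x *\<^sub>R indicator V x = (indicator (V \<inter> A) x :: real)" for A and x :: 'a
    by (auto simp: indicator_def)
  have *: "(LINT x:A|lebesgue. indicator V x) = measure lebesgue (V \<inter> A)" if "A \<in> lmeasurable" for A :: "'a set"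
    using that assms unfolding set_lebesgue_integral_def ind by simp
  have "V \<inter> box a (a + r *\<^sub>R One) \<in> lmeasurable"
    using assms(2) by (metis fmeasurable_Int_fmeasurable lebesgue_measurable_box(1) inf_commute)
  then have "set_integrable lebesgue (box a (a + r *\<^sub>R One)) (indicator V :: 'a \<Rightarrow> real)"
    unfolding set_integrable_def ind by (intro integrable_real_indicator) (auto simp only: fmeasurable_def mem_Collect_eq infinity_ennreal_def)
  from set_integral_subcubes[OF assms(1) this] show ?thesis
    by (simp add: * subcube_def)
qed

section \<open>Elementary inequalities for integrals over sets of finite measure\<close>

lemma set_integral_const_lebesgue:
  fixes A :: "'a::euclidean_space set" and c :: real
  assumes "A \<in> lmeasurable"
  shows "set_integrable lebesgue A (\<lambda>x. c)" "(LINT x:A|lebesgue. c) = measure lebesgue A * c" 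
proof -
  have "integrable lebesgue (indicator A :: 'a \<Rightarrow> real)"
    using assms by (intro integrable_real_indicator) (auto simp only: fmeasurable_def mem_Collect_eq infinity_ennreal_def)
  then show "set_integrable lebesgue A (\<lambda>x. c)"
    unfolding set_integrable_def by simp
  show "(LINT x:A|lebesgue. c) = measure lebesgue A * c"
    unfolding set_lebesgue_integral_def using assms by (simp add: fmeasurableD)
qed

lemma set_integrable_diff_const:
  fixes f :: "'a::euclidean_space \<Rightarrow> real"
  assumes "set_integrable lebesgue A f" "A \<in> lmeasurable"
  shows "set_integrable lebesgue A (\<lambda>x. f x - c)" 
    "set_integrable lebesgue A (\<lambda>x. \<bar>f x - c\<bar>)"
    "set_integrable lebesgue A (\<lambda>x. max (f x - c) 0)"
proof -
  have c: "set_integrable lebesgue A (\<lambda>x. c)" for c :: real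
    using assms(2) by (rule set_integral_const_lebesgue)
  show 1: "set_integrable lebesgue A (\<lambda>x. f x - c)" 
    by (intro set_integral_diff assms c)
  then show 2: "set_integrable lebesgue A (\<lambda>x. \<bar>f x - c\<bar>)" by (rule set_integrable_abs)
  have "set_integrable lebesgue A (\<lambda>x. ((f x - c) + \<bar>f x - c\<bar>) / 2)"
    by (intro set_integrable_divide set_integral_add 1 2)
  moreover have "((f x - c) + \<bar>f x - c\<bar>) / 2 = max (f x - c) 0" for x by (auto simp: max_def abs_if)
  ultimately show "set_integrable lebesgue A (\<lambda>x. max (f x - c) 0)" by simp
qed

lemma set_integral_nonneg_mono_set:
  fixes f :: "'a::euclidean_space \<Rightarrow> real"
  assumes "set_integrable lebesgue A f" "B \<in> sets lebesgue" "B \<subseteq> A" "\<And>x. x \<in> A \<Longrightarrow> 0 \<le> f x"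
  shows "(LINT x:B|lebesgue. f x) \<le> (LINT x:A|lebesgue. f x)"
proof -
  have "set_integrable lebesgue B f" using assms by (intro set_integrable_subset[OF assms(1)])
  with assms show ?thesis unfolding set_integrable_def set_lebesgue_integral_def
    by (intro integral_mono) (auto simp: indicator_def)
qed

text \<open>Chebyshev's inequality. It supplies the lower bounds for oscillation and excess
  integrals and the tail estimate for the distribution function.\<close>

lemma set_integral_const_le:
  fixes f :: "'a::euclidean_space \<Rightarrow> real"
  assumes "set_integrable lebesgue A f" "B \<in> sets lebesgue" "B \<subseteq> A" "A \<in> lmeasurable"
    "\<And>x. x \<in> A \<Longrightarrow> 0 \<le> f x" "\<And>x. x \<in> B \<Longrightarrow> c \<le> f x"
  shows "measure lebesgue B * c \<le> (LINT x:A|lebesgue. f x)"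
proof -
  have B: "B \<in> lmeasurable" using assms fmeasurableI2 by blast
  have "measure lebesgue B * c = (LINT x:B|lebesgue. c)" using B by (simp add: set_integral_const_lebesgue)
  also have "\<dots> \<le> (LINT x:B|lebesgue. f x)"
    using assms B by (intro set_integral_mono set_integral_const_lebesgue set_integrable_subset[OF assms(1)]) auto
  also have "\<dots> \<le> (LINT x:A|lebesgue. f x)" by (rule set_integral_nonneg_mono_set) fact+
  finally show ?thesis .
qed

subsection \<open>Mean oscillation and the excess over a level\<close>

lemma mean_oscillation_nonneg: "0 \<le> mean_oscillation f S"
  unfolding mean_oscillation_def set_lebesgue_integral_def
  by (intro mult_nonneg_nonneg integral_nonneg_AE) auto

text \<open>The mean is optimal among all constants up to the factor 2: its distance to
  \<open>c\<close> is at most the average of |f - c|, so passing from \<open>c\<close> to the mean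
  at most doubles the average deviation.\<close>

lemma mean_oscillation_le:
  fixes f :: "'a::euclidean_space \<Rightarrow> real"
  assumes "set_integrable lebesgue S f" "S \<in> lmeasurable" "0 < measure lebesgue S"
  shows "mean_oscillation f S \<le> 2 / measure lebesgue S * (LINT x:S|lebesgue. \<bar>f x - c\<bar>)"
proof -
  define s m I where "s = measure lebesgue S" and "m = mean_value f S"
    and "I = (LINT x:S|lebesgue. \<bar>f x - c\<bar>)"
  have "0 < s" using assms by (simp add: s_def)
  note int = set_integrable_diff_const[OF assms(1,2)]
  note const = set_integral_const_lebesgue[OF assms(2)]
  have "(LINT x:S|lebesgue. f x - c) = s * (m - c)"
    using \<open>0 < s\<close> set_integral_diff(2)[OF assms(1) const(1), of c]
    by (simp add: const s_def m_def mean_value_def right_diff_distrib)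
  then have "s * \<bar>m - c\<bar> = \<bar>LINT x:S|lebesgue. f x - c\<bar>"
    using \<open>0 < s\<close> by (simp add: abs_mult)
  also have "\<dots> \<le> I"
    using set_integral_norm_bound[OF int(1)] by (simp add: I_def)
  finally have m: "s * \<bar>m - c\<bar> \<le> I" .
  have "(LINT x:S|lebesgue. \<bar>f x - m\<bar>) \<le> (LINT x:S|lebesgue. \<bar>f x - c\<bar> + \<bar>m - c\<bar>)"
    by (intro set_integral_mono int set_integral_add const) auto
  also have "\<dots> = I + s * \<bar>m - c\<bar>"
    using set_integral_add(2)[OF int(2) const(1), of c "\<bar>m - c\<bar>"] by (simp add: I_def s_def const)
  also have "\<dots> \<le> 2 * I" using m by simp
  finally show ?thesis
    using \<open>0 < s\<close> unfolding mean_oscillation_def s_def[symmetric] m_def[symmetric] I_def[symmetric]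
    by (simp add: divide_right_mono)
qed

lemma mean_oscillation_le_of_bounds:
  fixes f :: "'a::euclidean_space \<Rightarrow> real"
  assumes "set_integrable lebesgue S f" "S \<in> lmeasurable" "0 < measure lebesgue S"
    "\<And>x. x \<in> S \<Longrightarrow> u \<le> f x" "\<And>x. x \<in> S \<Longrightarrow> f x \<le> v"
  shows "mean_oscillation f S \<le> 2 * (v - u)"
proof -
  have "(LINT x:S|lebesgue. \<bar>f x - u\<bar>) \<le> (LINT x:S|lebesgue. v - u)"
    using assms(4,5)
    by (intro set_integral_mono set_integrable_diff_const set_integral_const_lebesgue assms(1,2)) force
  also have "\<dots> = measure lebesgue S * (v - u)" by (rule set_integral_const_lebesgue) fact
  finally have "2 / measure lebesgue S * (LINT x:S|lebesgue. \<bar>f x - u\<bar>) \<le>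
    2 / measure lebesgue S * (measure lebesgue S * (v - u))"
    by (intro mult_left_mono) auto
  also have "\<dots> = 2 * (v - u)" using assms(3) by simp
  finally show ?thesis using mean_oscillation_le[OF assms(1-3), of u] by linarith
qed

text \<open>With m the mean of \<open>f\<close>, the constant |m| is compared with |f|, and ||f| -
  |m|| \<le> |f - m|. The factor 2 is the price of not using the mean of |f| itself.\<close>

lemma mean_oscillation_abs:
  fixes f :: "'a::euclidean_space \<Rightarrow> real"
  assumes "set_integrable lebesgue S f" "S \<in> lmeasurable" "0 < measure lebesgue S"
  shows "mean_oscillation (\<lambda>x. \<bar>f x\<bar>) S \<le> 2 * mean_oscillation f S"
proof -
  define m where "m = mean_value f S"
  have "mean_oscillation (\<lambda>x. \<bar>f x\<bar>) S \<le> 2 / measure lebesgue S * (LINT x:S|lebesgue. \<bar>\<bar>f x\<bar> - \<bar>m\<bar>\<bar>)"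
    by (intro mean_oscillation_le set_integrable_abs assms)
  also have "\<dots> \<le> 2 / measure lebesgue S * (LINT x:S|lebesgue. \<bar>f x - m\<bar>)"
    by (intro mult_left_mono set_integral_mono set_integrable_diff_const set_integrable_abs assms) auto
  finally show ?thesis by (simp add: mean_oscillation_def m_def)
qed

lemma sets_Int_lmeasurable:
  "V \<in> sets lebesgue \<Longrightarrow> S \<in> lmeasurable \<Longrightarrow> V \<inter> S \<in> lmeasurable"
  by (rule fmeasurableI2[of S]) (auto simp: fmeasurableD)

lemma set_integral_measure_zero:
  fixes f :: "'a::euclidean_space \<Rightarrow> real"
  assumes "S \<in> lmeasurable" "measure lebesgue S = 0"
  shows "(LINT x:S|lebesgue. f x) = 0"
proof -
  have "AE x in lebesgue. x \<notin> S"
    using assms by (metis AE_not_in emeasure_eq_measure2 ennreal_0 fmeasurableD null_setsI)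
  then show ?thesis
    unfolding set_lebesgue_integral_def
    by (intro integral_eq_zero_AE) (auto elim: eventually_mono)
qed

text \<open>At least half of \<open>S\<close> lies outside \<open>V\<close>, where \<open>g\<close>
  is at most \<open>c\<close>. If the mean m exceeds \<open>c\<close>, then |g - m| \<ge> m - c
  there, so the positive part of m - c is at most twice the mean oscillation. Since the excess is at
  most |g - m| plus this positive part, the factor is 1 + 2 = 3.\<close>

lemma set_integral_excess_le:
  fixes g :: "'a::euclidean_space \<Rightarrow> real"
  assumes int: "set_integrable lebesgue S g" and S: "S \<in> lmeasurable"
    and V: "V \<in> sets lebesgue" "measure lebesgue (V \<inter> S) \<le> measure lebesgue S / 2"
    and le: "\<And>x. x \<in> S - V \<Longrightarrow> g x \<le> c"
  shows "(LINT x:S|lebesgue. max (g x - c) 0) \<le> 3 * measure lebesgue S * mean_oscillation g S"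
proof (cases "measure lebesgue S = 0")
  case True
  then show ?thesis using set_integral_measure_zero[OF S True] by simp
next
  case False
  define s m where "s = measure lebesgue S" and "m = mean_value g S"
  have s: "0 < s" using False by (simp add: s_def zero_less_measure_iff)
  note ints = set_integrable_diff_const[OF int S]
  have osc: "(LINT x:S|lebesgue. \<bar>g x - m\<bar>) = s * mean_oscillation g S"
    using s by (simp add: mean_oscillation_def s_def m_def)
  have "s / 2 \<le> measure lebesgue (S - V)"
  proof -
    have "measure lebesgue (S - V) = s - measure lebesgue (V \<inter> S)"
      using measurable_measure_Diff[OF S, of "V \<inter> S"] S V(1)
      by (simp add: s_def fmeasurableD Diff_Int Int_commute)
    with V show ?thesis by (simp add: s_def)
  qed
  moreover have "measure lebesgue (S - V) * max (m - c) 0 \<le> (LINT x:S|lebesgue. \<bar>g x - m\<bar>)"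
    using le V S by (intro set_integral_const_le ints) (auto simp: fmeasurableD, fastforce)
  ultimately have "s / 2 * max (m - c) 0 \<le> s * mean_oscillation g S"
    unfolding osc by (meson max.cobounded2 mult_right_mono order_trans)
  then have m: "s * max (m - c) 0 \<le> 2 * s * mean_oscillation g S" by simp
  have "(LINT x:S|lebesgue. max (g x - c) 0) \<le> (LINT x:S|lebesgue. \<bar>g x - m\<bar> + max (m - c) 0)"
    by (intro set_integral_mono ints set_integral_add set_integral_const_lebesgue S) auto
  also have "\<dots> = s * mean_oscillation g S + s * max (m - c) 0"
    using set_integral_add(2)[OF ints(2) set_integral_const_lebesgue(1)[OF S], of m "max (m - c) 0"]
    by (simp add: osc set_integral_const_lebesgue(2)[OF S] s_def)
  also have "\<dots> \<le> 3 * s * mean_oscillation g S" using m by linarith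
  finally show ?thesis by (simp add: s_def)
qed

section \<open>Calderon-Zygmund stopping argument for the excess\<close>

text \<open>
  Sandwiching the level set between a compact \<open>K\<close> and an open \<open>V\<close> makes the stopping argument a
  finite induction that needs no Lebesgue density theorem: a cube of side at most \<open>d\<close> misses \<open>K\<close> or lies in \<open>V\<close>.
  A cube in which \<open>V\<close> has density at most \<open>2\<^sup>-\<^sup>n\<^sup>-\<^sup>1\<close> is subdivided, its children having density at most \<open>1/2\<close>.
\<close>

lemma dyadic_excess_bound:
  fixes g :: "'a::euclidean_space \<Rightarrow> real" and Q :: "'a set"
  assumes int: "set_integrable lebesgue Q g"
    and V: "V \<in> sets lebesgue" and K: "K \<in> sets lebesgue" and Q: "Q \<in> lmeasurable"
    and le: "\<And>x. x \<in> Q - V \<Longrightarrow> g x \<le> c" and w: "0 \<le> w"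
    and osc: "\<And>b r. 0 < r \<Longrightarrow> box b (b + r *\<^sub>R One) \<subseteq> Q \<Longrightarrow>
       r ^ DIM('a) \<le> 2 * 2 ^ DIM('a) * measure lebesgue (V \<inter> Q) \<Longrightarrow> mean_oscillation g (box b (b + r *\<^sub>R One)) \<le> w"
    and small: "\<And>b r. 0 < r \<Longrightarrow> r \<le> d \<Longrightarrow> box b (b + r *\<^sub>R One) \<subseteq> Q \<Longrightarrow>
       box b (b + r *\<^sub>R One) \<inter> K = {} \<or> box b (b + r *\<^sub>R One) \<subseteq> V"
  shows "\<lbrakk>0 < r; r \<le> 2 ^ k * d; box b (b + r *\<^sub>R One) \<subseteq> Q;
      measure lebesgue (V \<inter> box b (b + r *\<^sub>R One)) \<le> r ^ DIM('a) / 2\<rbrakk> \<Longrightarrow>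
    (LINT x:box b (b + r *\<^sub>R One)|lebesgue. indicator K x * max (g x - c) 0)
      \<le> 6 * 2 ^ DIM('a) * w * measure lebesgue (V \<inter> box b (b + r *\<^sub>R One))"
proof (induction k arbitrary: b r)
  case 0
  let ?D = "box b (b + r *\<^sub>R One)"
  \<comment> \<open>Density at most 1/2 rules out containment in \<open>V\<close>, so at this scale
    the cube misses \<open>K\<close> and the integrand vanishes on it.\<close>
  have "\<not> ?D \<subseteq> V"
  proof
    assume "?D \<subseteq> V"
    then have "V \<inter> ?D = ?D" by blast
    then have "r ^ DIM('a) \<le> r ^ DIM('a) / 2" using 0 by (simp add: measure_cube)
    moreover have "0 < r ^ DIM('a)" using 0 by simp
    ultimately show False by simp
  qed
  then have disj: "?D \<inter> K = {}" using 0 small by auto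
  have "indicator ?D x *\<^sub>R (indicator K x * max (g x - c) 0) = 0" for x
    using disj by (auto simp: indicator_def)
  then have "(LINT x:?D|lebesgue. indicator K x * max (g x - c) 0) = 0"
    unfolding set_lebesgue_integral_def by (simp only: integral_zero)
  then show ?case using w by simp
next
  case (Suc k)
  let ?D = "box b (b + r *\<^sub>R One)" and ?n = "DIM('a)"
  let ?h = "\<lambda>x. indicator K x * max (g x - c) 0"
  have gD: "set_integrable lebesgue ?D g" 
    using Suc.prems by (intro set_integrable_subset[OF int]) auto
  have eD: "set_integrable lebesgue ?D (\<lambda>x. max (g x - c) 0)"
    by (rule set_integrable_diff_const[OF gD]) simp
  have "set_integrable lebesgue (?D \<inter> K) (\<lambda>x. max (g x - c) 0)"
    using K by (intro set_integrable_subset[OF eD]) auto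
  then have hD: "set_integrable lebesgue ?D ?h"
    unfolding set_integrable_def by (simp add: indicator_inter_arith mult.assoc)
  show ?case
  \<comment> \<open>Stopping rule: once \<open>V\<close> has density at least 2^(-n-1) in the cube,
    the measure of the cube is charged to \<open>V \<inter> ?D\<close> and the half-density estimate
    is applied.\<close>
  proof (cases "r ^ ?n \<le> 2 * 2 ^ ?n * measure lebesgue (V \<inter> ?D)")
    case True
    \<comment> \<open>Passing from \<open>?D\<close> to \<open>Q\<close> makes the size restriction
      in \<open>osc\<close> the same for all stopping cubes.\<close>
    have VQ: "measure lebesgue (V \<inter> ?D) \<le> measure lebesgue (V \<inter> Q)"
      using Suc.prems V Q by (intro measure_mono_fmeasurable) (auto simp: sets_Int_lmeasurable)
    have "r ^ ?n \<le> 2 * 2 ^ ?n * measure lebesgue (V \<inter> Q)"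
      using True VQ by (smt (verit) mult_left_mono zero_le_power)
    then have o: "mean_oscillation g ?D \<le> w" using Suc.prems by (intro osc) auto
    have "(LINT x:?D|lebesgue. ?h x) \<le> (LINT x:?D|lebesgue. max (g x - c) 0)"
      by (intro set_integral_mono hD eD) (auto simp: indicator_def)
    also have "\<dots> \<le> 3 * measure lebesgue ?D * mean_oscillation g ?D"
      using Suc.prems V le by (intro set_integral_excess_le[OF gD]) (auto simp: measure_cube)
    also have "\<dots> \<le> 3 * r ^ ?n * w"
      using o Suc.prems by (simp add: measure_cube mult_left_mono)
    also have "\<dots> \<le> 3 * (2 * 2 ^ ?n * measure lebesgue (V \<inter> ?D)) * w"
      using True w by (intro mult_right_mono mult_left_mono) auto
    finally show ?thesis by (simp add: mult_ac)
  next
    case False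
    have "(LINT x:subcube b r S|lebesgue. ?h x) \<le> 6 * 2 ^ ?n * w * measure lebesgue (V \<inter> subcube b r S)"
      if "S \<in> Pow Basis" for S
      unfolding subcube_def
    proof (rule Suc.IH)
      have sub: "subcube b r S \<subseteq> ?D" using that Suc.prems by (intro subcube_subset) auto
      then show "box (b + (r / 2) *\<^sub>R \<Sum> S) (b + (r / 2) *\<^sub>R \<Sum> S + (r / 2) *\<^sub>R One) \<subseteq> Q"
        using Suc.prems unfolding subcube_def by blast
      have "measure lebesgue (V \<inter> subcube b r S) \<le> measure lebesgue (V \<inter> ?D)"
        using sub V by (intro measure_mono_fmeasurable) (auto simp: subcube_def sets_Int_lmeasurable)
      then have "2 * 2 ^ ?n * measure lebesgue (V \<inter> subcube b r S) \<le> r ^ ?n"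
        using False by (smt (verit) mult_left_mono zero_le_power)
      then show "measure lebesgue (V \<inter> box (b + (r / 2) *\<^sub>R \<Sum> S) (b + (r / 2) *\<^sub>R \<Sum> S + (r / 2) *\<^sub>R One)) \<le> (r / 2) ^ ?n / 2"
        by (simp add: subcube_def power_divide field_simps)
    qed (use Suc.prems in auto)
    \<comment> \<open>Both sides are additive over the children, so the constant does not grow with
      the depth \<open>k\<close>.\<close>
    then have "(\<Sum>S\<in>Pow Basis. LINT x:subcube b r S|lebesgue. ?h x) \<le>
      (\<Sum>S\<in>Pow Basis. 6 * 2 ^ ?n * w * measure lebesgue (V \<inter> subcube b r S))"
      by (rule sum_mono)
    then show ?thesis
      using Suc.prems by (simp only: set_integral_subcubes[OF _ hD] measure_Int_subcubes[OF _ V] sum_distrib_left)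
  qed
qed

text \<open>\<open>K\<close> and the complement of \<open>V\<close> have some positive distance e. A
  cube of side at most e / (2n) has diameter at most e / 2 by the l1 bound on the norm, so it cannot
  meet both.\<close>

lemma small_cube_dichotomy:
  fixes K V :: "'a::euclidean_space set"
  assumes "compact K" "open V" "K \<subseteq> V"
  obtains d where "0 < d" "\<And>b r. 0 < r \<Longrightarrow> r \<le> d \<Longrightarrow> 
       box b (b + r *\<^sub>R One) \<inter> K = {} \<or> box b (b + r *\<^sub>R One) \<subseteq> V"
proof -
  obtain e where e: "0 < e" "\<And>x y. x \<in> K \<Longrightarrow> y \<in> - V \<Longrightarrow> e \<le> dist x y"
    using separate_compact_closed[of K "- V"] assms closed_Compl[of V] by blast
  define d where "d = e / (2 * DIM('a))"
  show thesis
  proof (rule that)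
    show "0 < d" using e by (simp add: d_def)
    fix b :: 'a and r :: real assume r: "0 < r" "r \<le> d"
    let ?D = "box b (b + r *\<^sub>R One)"
    show "?D \<inter> K = {} \<or> ?D \<subseteq> V"
    proof (rule ccontr)
      assume "\<not> ?thesis"
      then obtain x y where xy: "x \<in> ?D" "x \<in> K" "y \<in> ?D" "y \<notin> V" by blast
      have "e \<le> dist x y" using e xy by auto
      also have "\<dots> \<le> (\<Sum>i\<in>Basis. \<bar>(x - y) \<bullet> i\<bar>)" unfolding dist_norm by (rule norm_le_l1)
      also have "\<dots> \<le> (\<Sum>i\<in>(Basis :: 'a set). r)"
      proof (rule sum_mono)
        fix i :: 'a assume "i \<in> Basis"
        then show "\<bar>(x - y) \<bullet> i\<bar> \<le> r"
          using xy by (fastforce simp: mem_box inner_diff_left)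
      qed
      also have "\<dots> \<le> DIM('a) * d" using r by simp
      also have "\<dots> = e / 2" by (simp add: d_def)
      finally show False using e by simp
    qed
  qed
qed

text \<open>The dyadic bound is applied to an open \<open>V\<close> around \<open>E\<close> with |V|
  \<le> 2|E| and to compact sets exhausting \<open>E\<close> up to a null set. As \<open>E\<close>
  fills at most a quarter of \<open>Q\<close>, \<open>V\<close> fills at most half; the factor 2
  turns the constant 6 into 12.\<close>

lemma set_integral_excess_weak_bound:
  fixes g :: "'a::euclidean_space \<Rightarrow> real" and a :: 'a and R w c :: real
  defines "Q \<equiv> box a (a + R *\<^sub>R One)"
  defines "E \<equiv> {x\<in>Q. c < g x}"
  assumes R: "0 < R" and int: "set_integrable lebesgue Q g" and w: "0 \<le> w"
    and E: "measure lebesgue E \<le> R ^ DIM('a) / 4"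
    and osc: "\<And>b r. 0 < r \<Longrightarrow> box b (b + r *\<^sub>R One) \<subseteq> Q \<Longrightarrow>
       r ^ DIM('a) \<le> 4 * 2 ^ DIM('a) * measure lebesgue E \<Longrightarrow> mean_oscillation g (box b (b + r *\<^sub>R One)) \<le> w"
  shows "(LINT x:Q|lebesgue. max (g x - c) 0) \<le> 12 * 2 ^ DIM('a) * w * measure lebesgue E"
proof -
  let ?n = "DIM('a)"
  let ?m = "measure lebesgue E"
  have Q: "Q \<in> lmeasurable" "Q \<in> sets lebesgue" by (auto simp: Q_def)
  have "(\<lambda>x. indicator Q x *\<^sub>R max (g x - c) 0) \<in> borel_measurable lebesgue"
    using set_integrable_diff_const(3)[OF int Q(1), of c] unfolding set_integrable_def by blast
  then have "{x\<in>space lebesgue. 0 < indicator Q x *\<^sub>R max (g x - c) 0} \<in> sets lebesgue"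
    by measurable
  also have "{x\<in>space lebesgue. 0 < indicator Q x *\<^sub>R max (g x - c) 0} = E"
    by (auto simp: E_def indicator_def split: if_splits)
  finally have Es: "E \<in> sets lebesgue" .
  then have El: "E \<in> lmeasurable" using Q by (rule_tac fmeasurableI2[of Q]) (auto simp: E_def)
  have eQ: "set_integrable lebesgue Q (\<lambda>x. max (g x - c) 0)"
    by (rule set_integrable_diff_const) fact+
  then have eE: "set_integrable lebesgue E (\<lambda>x. max (g x - c) 0)"
    using Es by (rule set_integrable_subset) (auto simp: E_def)
  have QE: "(LINT x:Q|lebesgue. max (g x - c) 0) = (LINT x:E|lebesgue. max (g x - c) 0)"
    unfolding set_lebesgue_integral_def E_def by (intro Bochner_Integration.integral_cong) (auto simp: indicator_def)
  show ?thesis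
  \<comment> \<open>A null \<open>E\<close> is treated apart, because the outer approximation uses
    \<open>?m\<close> as a positive tolerance.\<close>
  proof (cases "?m = 0")
    case True
    then show ?thesis using QE set_integral_measure_zero[OF El True] by simp
  next
    case False
    then have m: "0 < ?m" by (simp add: zero_less_measure_iff)
    obtain V where V: "open V" "E \<subseteq> V" "V - E \<in> lmeasurable" "emeasure lebesgue (V - E) < ennreal ?m"
      using sets_lebesgue_outer_open[OF Es m] by metis
    have VE: "measure lebesgue (V - E) \<le> ?m"
      using V(4) m by (metis V(3) emeasure_eq_measure2 ennreal_less_iff less_eq_real_def measure_nonneg)
    have "V = E \<union> (V - E)" using V by blast
    then have Vl: "V \<in> lmeasurable" using El V(3) by (metis fmeasurable.Un)
    have "measure lebesgue V \<le> 2 * ?m"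
      using measure_Un_le[of E lebesgue "V - E"] \<open>V = E \<union> (V - E)\<close> Es V(3) VE fmeasurableD by force
    then have VQ: "measure lebesgue (V \<inter> Q) \<le> 2 * ?m"
      using measure_mono_fmeasurable[of "V \<inter> Q" V lebesgue] Vl Q by (auto simp: fmeasurableD)
    obtain N C where NC: "negligible N" "\<And>n::nat. compact (C n)" "E = \<Union>(range C) \<union> N"
      using lebesgue_regular_inner[OF Es] by metis
    define K where "K n = (\<Union>i\<le>n. C i)" for n :: nat
    have K: "compact (K n)" "K n \<subseteq> E" for n
      using NC by (auto simp: K_def intro!: compact_UN)
    have Ks: "K n \<in> sets lebesgue" for n
      using K compact_imp_closed by (metis borel_closed sets_completionI_sets sets_lborel)
    have bound: "(LINT x:K n|lebesgue. max (g x - c) 0) \<le> 12 * 2 ^ ?n * w * ?m" for n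
    proof -
      obtain d where d: "0 < d" "\<And>b r. 0 < r \<Longrightarrow> r \<le> d \<Longrightarrow> 
         box b (b + r *\<^sub>R One) \<inter> K n = {} \<or> box b (b + r *\<^sub>R One) \<subseteq> V"
        using small_cube_dichotomy[of "K n" V] K[of n] V by (metis subset_trans)
      \<comment> \<open>\<open>k\<close> halvings bring the side from \<open>R\<close> down to at
        most \<open>d\<close>. Both depend on \<open>n\<close>, but the resulting bound does
        not.\<close>
      obtain k where "R / d < 2 ^ k" using real_arch_pow[of 2 "R / d"] by auto
      then have k: "R \<le> 2 ^ k * d" using d by (simp add: field_simps)
      have "(LINT x:Q|lebesgue. indicator (K n) x * max (g x - c) 0) \<le> 6 * 2 ^ ?n * w * measure lebesgue (V \<inter> Q)"
        unfolding Q_def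
      proof (rule dyadic_excess_bound[where d=d and k=k])
        show "set_integrable lebesgue Q g" by fact
        show "g x \<le> c" if "x \<in> Q - V" for x using that V by (auto simp: E_def)
        show "mean_oscillation g (box b (b + r *\<^sub>R One)) \<le> w"
          if "0 < r" "box b (b + r *\<^sub>R One) \<subseteq> Q" "r ^ ?n \<le> 2 * 2 ^ ?n * measure lebesgue (V \<inter> Q)" for b r
        proof (rule osc)
          have "2 * 2 ^ ?n * measure lebesgue (V \<inter> Q) \<le> 2 * 2 ^ ?n * (2 * ?m)"
            using VQ by (intro mult_left_mono) auto
          with that(3) have "r ^ ?n \<le> 2 * 2 ^ ?n * (2 * ?m)" by (rule order_trans)
          then show "r ^ ?n \<le> 4 * 2 ^ ?n * ?m" by simp
        qed fact+
        show "measure lebesgue (V \<inter> box a (a + R *\<^sub>R One)) \<le> R ^ ?n / 2"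
          using VQ E by (simp add: Q_def)
      qed (use Q Vl Ks w R d k in \<open>auto simp: fmeasurableD Q_def\<close>)
      also have "\<dots> \<le> 6 * 2 ^ ?n * w * (2 * ?m)"
        using VQ w by (intro mult_left_mono) auto
      also have "(LINT x:Q|lebesgue. indicator (K n) x * max (g x - c) 0) = (LINT x:K n|lebesgue. max (g x - c) 0)"
        using K[of n] unfolding set_lebesgue_integral_def
        by (intro Bochner_Integration.integral_cong) (auto simp: indicator_def E_def)
      finally show ?thesis by simp
    qed
    have "E = (\<Union>n. K n) \<union> N" using NC(3) by (auto simp: K_def)
    \<comment> \<open>The sets \<open>K n\<close> increase and their union is \<open>E\<close> up to
      a null set, so the uniform bound passes to \<open>E\<close>.\<close>
    have "(\<lambda>n. LINT x:K n|lebesgue. max (g x - c) 0) \<longlonglongrightarrow> (LINT x:(\<Union>n. K n)|lebesgue. max (g x - c) 0)"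
    proof (rule set_integral_cont_up)
      show "incseq K" unfolding incseq_def K_def by (intro allI impI UN_mono) auto
      show "set_integrable lebesgue (\<Union>n. K n) (\<lambda>x. max (g x - c) 0)"
        using Ks K by (intro set_integrable_subset[OF eE]) auto
    qed (rule Ks)
    then have "(LINT x:(\<Union>n. K n)|lebesgue. max (g x - c) 0) \<le> 12 * 2 ^ ?n * w * ?m"
      by (rule LIMSEQ_le_const2) (use bound in auto)
    moreover have "(LINT x:E|lebesgue. max (g x - c) 0) = (LINT x:(\<Union>n. K n)|lebesgue. max (g x - c) 0)"
    proof (rule set_integral_cong_set)
      have "N \<in> null_sets lebesgue" using NC(1) negligible_iff_null_sets by blast
      then have "AE x in lebesgue. x \<notin> N" by (rule AE_not_in)
      then show "AE x in lebesgue. (x \<in> (\<Union>n. K n)) = (x \<in> E)"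
        by eventually_elim (use \<open>E = (\<Union>n. K n) \<union> N\<close> in blast)
      show "set_borel_measurable lebesgue E (\<lambda>x. max (g x - c) 0)"
        using eE unfolding set_borel_measurable_def set_integrable_def by blast
      have "set_integrable lebesgue (\<Union>n. K n) (\<lambda>x. max (g x - c) 0)"
        using Ks K by (intro set_integrable_subset[OF eE]) auto
      then show "set_borel_measurable lebesgue (\<Union>n. K n) (\<lambda>x. max (g x - c) 0)"
        unfolding set_borel_measurable_def set_integrable_def by blast
    qed
    ultimately show ?thesis using QE by simp
  qed
qed

subsection \<open>Vanishing oscillation excludes gaps in the range\<close>

text \<open>The factor \<open>c = \<plusminus>1\<close> turns this into a lower or an upper density bound.\<close>

lemma exists_dyadic_subcube_density_ge:
  fixes a :: "'a::euclidean_space"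
  assumes "0 < R" "E \<in> sets lebesgue"
    and "t * R ^ DIM('a) \<le> c * measure lebesgue (E \<inter> box a (a + R *\<^sub>R One))"
  shows "\<exists>b. box b (b + (R / 2 ^ k) *\<^sub>R One) \<subseteq> box a (a + R *\<^sub>R One) \<and>
    t * (R / 2 ^ k) ^ DIM('a) \<le> c * measure lebesgue (E \<inter> box b (b + (R / 2 ^ k) *\<^sub>R One))"
proof (induction k)
  case 0
  then show ?case using assms by auto
next
  case (Suc k)
  define r where "r = R / 2 ^ k"
  have r: "0 < r" "R / 2 ^ Suc k = r / 2" using assms by (auto simp: r_def)
  let ?n = "DIM('a)"
  obtain b where b: "box b (b + r *\<^sub>R One) \<subseteq> box a (a + R *\<^sub>R One)"
    "t * r ^ ?n \<le> c * measure lebesgue (E \<inter> box b (b + r *\<^sub>R One))"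
    using Suc unfolding r_def by blast
  \<comment> \<open>If the bound failed on each of the 2^n children, summation would violate it on
    the parent.\<close>
  have "\<exists>S\<in>Pow Basis. t * (r / 2) ^ ?n \<le> c * measure lebesgue (E \<inter> subcube b r S)"
  proof (rule ccontr)
    assume "\<not> ?thesis"
    then have "(\<Sum>S\<in>Pow Basis. c * measure lebesgue (E \<inter> subcube b r S)) < (\<Sum>S\<in>Pow (Basis :: 'a set). t * (r / 2) ^ ?n)"
      by (intro sum_strict_mono) (auto simp: not_le)
    also have "\<dots> = t * r ^ ?n" by (simp add: card_Pow power_divide)
    finally show False
      using b r assms by (simp add: measure_Int_subcubes sum_distrib_left)
  qed
  then obtain S where S: "S \<subseteq> Basis" "t * (r / 2) ^ ?n \<le> c * measure lebesgue (E \<inter> subcube b r S)"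
    by blast
  have "subcube b r S \<subseteq> box a (a + R *\<^sub>R One)"
    using subcube_subset[OF S(1) r(1)] b by blast
  then show ?case
    using S unfolding r(2) subcube_def by blast
qed

text \<open>Both cubes contain the cube obtained by shrinking the first by \<open>dist b b'\<close>
  on every side. What the first cube has outside the second therefore lies in a shell, whose measure
  is the right-hand side.\<close>

lemma measure_Int_cube_diff_le:
  fixes b b' :: "'a::euclidean_space"
  assumes E: "E \<in> sets lebesgue" and r: "2 * dist b b' < r"
  shows "measure lebesgue (E \<inter> box b (b + r *\<^sub>R One)) - measure lebesgue (E \<inter> box b' (b' + r *\<^sub>R One))
    \<le> r ^ DIM('a) - (r - 2 * dist b b') ^ DIM('a)"
proof -
  define e where "e = dist b b'"
  have e: "0 \<le> e" "2 * e < r" using r by (auto simp: e_def)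
  let ?D = "box b (b + r *\<^sub>R One)" and ?D' = "box b' (b' + r *\<^sub>R One)"
  let ?I = "box (b + e *\<^sub>R One) (b + e *\<^sub>R One + (r - 2 * e) *\<^sub>R One)"
  have comp: "\<bar>b \<bullet> i - b' \<bullet> i\<bar> \<le> e" if "i \<in> Basis" for i
    using Basis_le_norm[OF that, of "b - b'"] by (simp add: e_def dist_norm inner_diff_left)
  have sub: "?I \<subseteq> box b'' (b'' + r *\<^sub>R One)" if b'': "\<And>i. i \<in> Basis \<Longrightarrow> \<bar>b \<bullet> i - b'' \<bullet> i\<bar> \<le> e" for b''
  proof
    fix x assume x: "x \<in> ?I"
    show "x \<in> box b'' (b'' + r *\<^sub>R One)" unfolding mem_box
    proof
      fix i :: 'a assume i: "i \<in> Basis"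
      then have "b \<bullet> i + e < x \<bullet> i" "x \<bullet> i < b \<bullet> i + e + (r - 2 * e)"
        using x by (auto simp: mem_box inner_add_left)
      then show "b'' \<bullet> i < x \<bullet> i \<and> x \<bullet> i < (b'' + r *\<^sub>R One) \<bullet> i"
        using b''[OF i] i by (auto simp: inner_add_left abs_le_iff)
    qed
  qed
  have I: "?I \<subseteq> ?D" "?I \<subseteq> ?D'"
    using e comp by (auto intro!: sub)
  have meas: "E \<inter> ?D' \<in> lmeasurable" "?D - ?I \<in> lmeasurable"
    using E by (auto intro!: sets_Int_lmeasurable fmeasurable_Diff)
  have "measure lebesgue (E \<inter> ?D) \<le> measure lebesgue ((E \<inter> ?D') \<union> (?D - ?I))"
    using E I meas by (intro measure_mono_fmeasurable fmeasurable.Un) auto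
  also have "\<dots> \<le> measure lebesgue (E \<inter> ?D') + measure lebesgue (?D - ?I)"
    using meas by (intro measure_Un_le) (auto simp: fmeasurableD)
  also have "measure lebesgue (?D - ?I) = r ^ DIM('a) - (r - 2 * e) ^ DIM('a)"
    using e I by (subst measurable_measure_Diff) (auto simp: measure_cube)
  finally show ?thesis by (simp add: e_def)
qed

lemma continuous_on_measure_Int_cube:
  fixes E :: "'a::euclidean_space set"
  assumes "E \<in> sets lebesgue" "0 < r"
  shows "continuous_on A (\<lambda>b. measure lebesgue (E \<inter> box b (b + r *\<^sub>R One)))" (is "continuous_on A ?\<phi>")
proof -
  have "isCont ?\<phi> b" for b
    unfolding isCont_def
  proof (rule LIM_zero_cancel)
    show "((\<lambda>b'. ?\<phi> b' - ?\<phi> b) \<longlongrightarrow> 0) (at b)"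
    proof (rule Lim_null_comparison)
      \<comment> \<open>Within distance \<open>r / 2\<close> the shift estimate applies in both
        directions.\<close>
      have "\<forall>\<^sub>F b' in at b. dist b' b < r / 2"
        using assms by (auto simp: eventually_at intro!: exI[of _ "r/2"])
      then show "\<forall>\<^sub>F b' in at b. norm (?\<phi> b' - ?\<phi> b) \<le> r ^ DIM('a) - (r - 2 * dist b' b) ^ DIM('a)"
      proof eventually_elim
        case (elim b')
        then show ?case
          using measure_Int_cube_diff_le[OF assms(1), of b' b r] measure_Int_cube_diff_le[OF assms(1), of b b' r]
          by (simp add: dist_commute abs_le_iff)
      qed
      have "((\<lambda>b'. r ^ DIM('a) - (r - 2 * dist b' b) ^ DIM('a)) \<longlongrightarrow> r ^ DIM('a) - (r - 2 * dist b b) ^ DIM('a)) (at b)"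
        by (intro tendsto_intros)
      then show "((\<lambda>b'. r ^ DIM('a) - (r - 2 * dist b' b) ^ DIM('a)) \<longlongrightarrow> 0) (at b)" by simp
    qed
  qed
  then show ?thesis by (simp add: continuous_at_imp_continuous_on)
qed

text \<open>Repeated halving towards dense and towards sparse children gives two cubes of the same
  small side, with density of \<open>E\<close> at least and at most \<open>t\<close>. The admissible
  corners form a closed box, which is connected, and the density depends continuously on the corner,
  so \<open>t\<close> is attained.\<close>

lemma exists_small_cube_same_density:
  fixes a :: "'a::euclidean_space"
  assumes R: "0 < R" and E: "E \<in> sets lebesgue" and "0 < \<delta>"
    and t: "measure lebesgue (E \<inter> box a (a + R *\<^sub>R One)) = t * R ^ DIM('a)"
  shows "\<exists>b r. 0 < r \<and> r ^ DIM('a) \<le> \<delta> \<and> box b (b + r *\<^sub>R One) \<subseteq> box a (a + R *\<^sub>R One) \<and>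
    measure lebesgue (E \<inter> box b (b + r *\<^sub>R One)) = t * r ^ DIM('a)"
proof -
  let ?n = "DIM('a)"
  \<comment> \<open>Since n \<ge> 1, (2^k)^n \<ge> 2^k, so 2^k > R^n / \<delta> already makes the
    measure of a cube of side R / 2^k at most \<delta>.\<close>
  obtain k where k: "R ^ ?n / \<delta> < 2 ^ k" using real_arch_pow[of 2 "R ^ ?n / \<delta>"] by auto
  define r where "r = R / 2 ^ k"
  have r: "0 < r" "r \<le> R" using R by (auto simp: r_def field_simps)
  have "r ^ ?n = R ^ ?n / (2 ^ k) ^ ?n" by (simp add: r_def power_divide)
  also have "\<dots> \<le> R ^ ?n / (2 ^ k) ^ 1"
    using R by (intro divide_left_mono power_increasing) (auto simp: DIM_positive Suc_leI)
  also have "\<dots> \<le> \<delta>" using k \<open>0 < \<delta>\<close> by (simp add: field_simps)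
  finally have small: "r ^ ?n \<le> \<delta>" .
  obtain b1 where b1: "box b1 (b1 + r *\<^sub>R One) \<subseteq> box a (a + R *\<^sub>R One)"
    "t * r ^ ?n \<le> measure lebesgue (E \<inter> box b1 (b1 + r *\<^sub>R One))"
    using exists_dyadic_subcube_density_ge[OF R E, of t 1 a k] t unfolding r_def by auto
  obtain b2 where b2: "box b2 (b2 + r *\<^sub>R One) \<subseteq> box a (a + R *\<^sub>R One)"
    "measure lebesgue (E \<inter> box b2 (b2 + r *\<^sub>R One)) \<le> t * r ^ ?n"
    using exists_dyadic_subcube_density_ge[OF R E, of "- t" "- 1" a k] t unfolding r_def by auto
  let ?A = "cbox a (a + (R - r) *\<^sub>R One)"
  have A: "b \<in> ?A \<longleftrightarrow> box b (b + r *\<^sub>R One) \<subseteq> box a (a + R *\<^sub>R One)" for b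
  proof -
    have "box b (b + r *\<^sub>R One) \<subseteq> box a (a + R *\<^sub>R One) \<longleftrightarrow>
      (\<forall>i\<in>Basis. a \<bullet> i \<le> b \<bullet> i \<and> (b + r *\<^sub>R One) \<bullet> i \<le> (a + R *\<^sub>R One) \<bullet> i)"
    proof -
      have "\<forall>i\<in>Basis. b \<bullet> i < (b + r *\<^sub>R One) \<bullet> i" using r(1) by (auto simp: inner_add_left)
      then show ?thesis using subset_box(4)[of b "b + r *\<^sub>R One" a "a + R *\<^sub>R One"] by blast
    qed
    also have "\<dots> \<longleftrightarrow> b \<in> ?A"
      unfolding mem_box by (intro ball_cong refl) (simp only: inner_cube_upper, linarith)
    finally show ?thesis by blast
  qed
  let ?\<phi> = "\<lambda>b. measure lebesgue (E \<inter> box b (b + r *\<^sub>R One))"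
  have "connected (?\<phi> ` ?A)"
    by (intro connected_continuous_image continuous_on_measure_Int_cube E r convex_connected convex_box)
  moreover have "b1 \<in> ?A" "b2 \<in> ?A" using b1(1) b2(1) by (simp_all only: A)
  then have "?\<phi> b1 \<in> ?\<phi> ` ?A" "?\<phi> b2 \<in> ?\<phi> ` ?A"
    by - (rule image_eqI[where x=b1], rule refl, assumption, rule image_eqI[where x=b2], rule refl, assumption)
  ultimately have "t * r ^ ?n \<in> ?\<phi> ` ?A"
    using b1(2) b2(2) by (rule_tac connectedD_interval)
  then obtain b where "b \<in> ?A" "?\<phi> b = t * r ^ ?n" by (elim imageE) (rule that, simp_all only:)
  then show ?thesis using A small r(1) by metis
qed

lemma superlevel_set_measurable:
  fixes g :: "'a::euclidean_space \<Rightarrow> real"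
  assumes "set_integrable lebesgue S g" "S \<in> lmeasurable"
  shows "{x\<in>S. c < g x} \<in> lmeasurable"
proof -
  have "(\<lambda>x. indicator S x *\<^sub>R g x) \<in> borel_measurable lebesgue"
    using assms unfolding set_integrable_def by blast
  then have "{x\<in>space lebesgue. c < indicator S x *\<^sub>R g x} \<in> sets lebesgue"
    by measurable
  then have "{x\<in>space lebesgue. c < indicator S x *\<^sub>R g x} \<inter> S \<in> lmeasurable"
    using assms(2) by (rule sets_Int_lmeasurable)
  also have "{x\<in>space lebesgue. c < indicator S x *\<^sub>R g x} \<inter> S = {x\<in>S. c < g x}"
    by (auto simp: indicator_def)
  finally show ?thesis .
qed

text \<open>Suppose the upper level set has density t strictly between 0 and 1. Arbitrarily small
  cubes then have density exactly t; on such a cube \<open>g\<close> is at most \<alpha> on the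
  fraction 1 - t and, up to a null set, above \<gamma> on the fraction t. The mean is at least
  (\<gamma> - \<alpha>) / 2 away from one of these two ranges, so the oscillation cannot
  vanish.\<close>

lemma vanishing_oscillation_no_gap:
  fixes g :: "'a::euclidean_space \<Rightarrow> real" and a :: 'a and R :: real
  defines "Q \<equiv> box a (a + R *\<^sub>R One)"
  assumes R: "0 < R" and int: "set_integrable lebesgue Q g" and "\<alpha> < \<gamma>"
    and eq: "measure lebesgue {x\<in>Q. \<gamma> < g x} = measure lebesgue {x\<in>Q. \<alpha> < g x}"
    and osc: "\<And>e. 0 < e \<Longrightarrow> \<exists>\<delta>>0. \<forall>b r. 0 < r \<longrightarrow> r ^ DIM('a) \<le> \<delta> \<longrightarrow> box b (b + r *\<^sub>R One) \<subseteq> Q \<longrightarrow>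
      mean_oscillation g (box b (b + r *\<^sub>R One)) \<le> e"
  shows "measure lebesgue {x\<in>Q. \<alpha> < g x} = 0 \<or> measure lebesgue {x\<in>Q. \<alpha> < g x} = measure lebesgue Q"
proof (rule ccontr)
  assume neg: "\<not> ?thesis"
  let ?n = "DIM('a)"
  define E E' where "E = {x\<in>Q. \<alpha> < g x}" and "E' = {x\<in>Q. \<gamma> < g x}"
  have Q: "Q \<in> lmeasurable" "measure lebesgue Q = R ^ ?n" using R by (auto simp: Q_def measure_cube)
  have EE: "E \<in> lmeasurable" "E' \<in> lmeasurable" "E' \<subseteq> E" "E \<subseteq> Q"
    using superlevel_set_measurable[OF int Q(1)] \<open>\<alpha> < \<gamma>\<close> by (auto simp: E_def E'_def)
  define t where "t = measure lebesgue E / R ^ ?n"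
  have "measure lebesgue E \<le> measure lebesgue Q"
    using EE Q by (intro measure_mono_fmeasurable) (auto simp: fmeasurableD)
  moreover have "0 \<le> measure lebesgue E" by simp
  ultimately have "0 < measure lebesgue E" "measure lebesgue E < R ^ ?n"
    using neg Q unfolding E_def[symmetric] by linarith+
  then have t: "0 < t" "t < 1" "measure lebesgue E = t * R ^ ?n" using R by (auto simp: t_def)
  \<comment> \<open>A lower bound for the mean oscillation on every cube of density
    \<open>t\<close>; the smallness hypothesis is invoked with \<open>p / 2\<close> to contradict
    it.\<close>
  define p where "p = min t (1 - t) * ((\<gamma> - \<alpha>) / 2)"
  have p: "0 < p" using t \<open>\<alpha> < \<gamma>\<close> by (simp add: p_def)
  then obtain \<delta> where \<delta>: "0 < \<delta>" "\<And>b r. 0 < r \<Longrightarrow> r ^ ?n \<le> \<delta> \<Longrightarrow> box b (b + r *\<^sub>R One) \<subseteq> Q \<Longrightarrow>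
      mean_oscillation g (box b (b + r *\<^sub>R One)) \<le> p / 2"
    using osc[of "p/2"] by auto
  have "E \<inter> box a (a + R *\<^sub>R One) = E" using EE by (auto simp: Q_def)
  then obtain b r where r: "0 < r" "r ^ ?n \<le> \<delta>" "box b (b + r *\<^sub>R One) \<subseteq> Q"
    "measure lebesgue (E \<inter> box b (b + r *\<^sub>R One)) = t * r ^ ?n"
    using exists_small_cube_same_density[OF R, of E \<delta> a t] EE \<delta> t by (auto simp: Q_def fmeasurableD)
  define D where "D = box b (b + r *\<^sub>R One)"
  have D: "D \<in> lmeasurable" "measure lebesgue D = r ^ ?n" "D \<subseteq> Q"
    using r by (auto simp: D_def measure_cube)
  define m where "m = mean_value g D"
  have gD: "set_integrable lebesgue D g"
    using D by (intro set_integrable_subset[OF int]) (auto simp: fmeasurableD)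
  note ints = set_integrable_diff_const[OF gD D(1)]
  have o: "(LINT x:D|lebesgue. \<bar>g x - m\<bar>) = r ^ ?n * mean_oscillation g D"
    using r D by (simp add: mean_oscillation_def m_def)
  have "r ^ ?n * p \<le> (LINT x:D|lebesgue. \<bar>g x - m\<bar>)"
  proof (cases "(\<alpha> + \<gamma>) / 2 \<le> m")
    case True
    have "measure lebesgue (D - E \<inter> D) = (1 - t) * r ^ ?n"
      using r D EE by (subst measurable_measure_Diff) (auto simp: D_def fmeasurableD left_diff_distrib)
    then have "r ^ ?n * p \<le> measure lebesgue (D - E \<inter> D) * ((\<gamma> - \<alpha>) / 2)"
      unfolding p_def using r \<open>\<alpha> < \<gamma>\<close> by (simp add: mult_ac mult_left_mono)
    also have "\<dots> \<le> (LINT x:D|lebesgue. \<bar>g x - m\<bar>)"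
    proof (intro set_integral_const_le ints)
      show "(\<gamma> - \<alpha>) / 2 \<le> \<bar>g x - m\<bar>" if "x \<in> D - E \<inter> D" for x
      proof -
        have "g x \<le> \<alpha>" using that D by (auto simp: E_def)
        with True abs_ge_minus_self[of "g x - m"] show ?thesis by (simp add: field_simps)
      qed
    qed (use D EE in \<open>auto simp: fmeasurableD\<close>)
    finally show ?thesis .
  next
    case False
    \<comment> \<open>The level sets are nested with equal measure, so replacing \<open>E\<close> by
      \<open>E'\<close> loses no measure inside \<open>D\<close>.\<close>
    have "measure lebesgue (E - E') = 0"
      using EE eq by (subst measurable_measure_Diff) (auto simp: fmeasurableD E_def E'_def)
    have "measure lebesgue (E \<inter> D) \<le> measure lebesgue ((E' \<inter> D) \<union> (E - E'))"
      using EE D by (intro measure_mono_fmeasurable fmeasurable.Un fmeasurable_Diff) (auto simp: fmeasurableD intro!: sets_Int_lmeasurable)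
    also have "\<dots> \<le> measure lebesgue (E' \<inter> D) + measure lebesgue (E - E')"
      using EE D by (intro measure_Un_le) (auto simp: fmeasurableD)
    finally have "t * r ^ ?n \<le> measure lebesgue (E' \<inter> D)"
      using r \<open>measure lebesgue (E - E') = 0\<close> by (simp add: D_def)
    then have "min t (1 - t) * r ^ ?n \<le> measure lebesgue (E' \<inter> D)"
      using r by (smt (verit) mult_right_mono zero_le_power min.cobounded1)
    then have "min t (1 - t) * r ^ ?n * ((\<gamma> - \<alpha>) / 2) \<le> measure lebesgue (E' \<inter> D) * ((\<gamma> - \<alpha>) / 2)"
      using \<open>\<alpha> < \<gamma>\<close> by (intro mult_right_mono) auto
    then have "r ^ ?n * p \<le> measure lebesgue (E' \<inter> D) * ((\<gamma> - \<alpha>) / 2)"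
      unfolding p_def by (simp only: mult_ac)
    also have "\<dots> \<le> (LINT x:D|lebesgue. \<bar>g x - m\<bar>)"
    proof (intro set_integral_const_le ints)
      show "(\<gamma> - \<alpha>) / 2 \<le> \<bar>g x - m\<bar>" if "x \<in> E' \<inter> D" for x
      proof -
        have "\<gamma> < g x" using that by (auto simp: E'_def)
        with False abs_ge_self[of "g x - m"] show ?thesis by (simp add: field_simps)
      qed
    qed (use D EE in \<open>auto simp: fmeasurableD\<close>)
    finally show ?thesis .
  qed
  also have "\<dots> \<le> r ^ ?n * (p / 2)"
    unfolding o using \<delta>(2)[OF r(1-3)] r by (intro mult_left_mono) (auto simp: D_def)
  finally have "p \<le> p / 2" using r by (simp add: mult_le_cancel_left_pos)
  then show False using p by simp
qed

subsection \<open>The decreasing rearrangement\<close>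

lemma superlevel_abs_lmeasurable:
  fixes f :: "'a::euclidean_space \<Rightarrow> real"
  assumes "set_integrable lebesgue S f" "S \<in> lmeasurable"
  shows "{x\<in>S. c < \<bar>f x\<bar>} \<in> lmeasurable"
  using superlevel_set_measurable[OF set_integrable_abs[OF assms(1)] assms(2)] .

lemma distribution_function_antimono:
  fixes f :: "'a::euclidean_space \<Rightarrow> real"
  assumes "set_integrable lebesgue S f" "S \<in> lmeasurable" "\<alpha> \<le> \<beta>"
  shows "distribution_function S f \<beta> \<le> distribution_function S f \<alpha>"
  unfolding distribution_function_def
  using superlevel_abs_lmeasurable[OF assms(1,2)] assms(3)
  by (intro measure_mono_fmeasurable) (auto simp: fmeasurableD)

lemma distribution_function_le_measure:
  fixes f :: "'a::euclidean_space \<Rightarrow> real"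
  assumes "set_integrable lebesgue S f" "S \<in> lmeasurable"
  shows "distribution_function S f \<alpha> \<le> measure lebesgue S"
  unfolding distribution_function_def
  using superlevel_abs_lmeasurable[OF assms(1,2)] assms(2)
  by (intro measure_mono_fmeasurable) (auto simp: fmeasurableD)

text \<open>Right-continuity of the distribution function: the level set at \<alpha> is the
  increasing union of those at \<alpha> + 1/(k+1), and measure is continuous from below.\<close>

lemma distribution_function_gt_right:
  fixes f :: "'a::euclidean_space \<Rightarrow> real"
  assumes "set_integrable lebesgue S f" "S \<in> lmeasurable" "s < distribution_function S f \<alpha>"
  shows "\<exists>\<beta>>\<alpha>. s < distribution_function S f \<beta>"
proof -
  let ?A = "\<lambda>k::nat. {x\<in>S. \<alpha> + 1 / real (Suc k) < \<bar>f x\<bar>}"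
  note meas = superlevel_abs_lmeasurable[OF assms(1,2)]
  have U: "(\<Union>k. ?A k) = {x\<in>S. \<alpha> < \<bar>f x\<bar>}"
  proof (intro set_eqI iffI)
    fix x assume "x \<in> {x\<in>S. \<alpha> < \<bar>f x\<bar>}"
    then have x: "x \<in> S" "0 < \<bar>f x\<bar> - \<alpha>" by auto
    then obtain k where "1 / real (Suc k) < \<bar>f x\<bar> - \<alpha>" using nat_approx_posE by metis
    then show "x \<in> (\<Union>k. ?A k)" using x by (auto intro!: exI[of _ k])
  next
    fix x assume "x \<in> (\<Union>k. ?A k)"
    then obtain k where k: "x \<in> S" "\<alpha> + 1 / real (Suc k) < \<bar>f x\<bar>" by auto
    have "0 < 1 / real (Suc k)" by simp
    then have "\<alpha> < \<bar>f x\<bar>" using k(2) by linarith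
    with k show "x \<in> {x\<in>S. \<alpha> < \<bar>f x\<bar>}" by simp
  qed
  have "(\<lambda>k. measure lebesgue (?A k)) \<longlonglongrightarrow> measure lebesgue (\<Union>k. ?A k)"
  proof (rule Lim_measure_incseq)
    show "range ?A \<subseteq> sets lebesgue" using meas by (auto simp: fmeasurableD)
    show "incseq ?A"
    proof (rule incseq_SucI)
      fix k
      have "1 / real (Suc (Suc k)) \<le> 1 / real (Suc k)" by (simp add: field_simps)
      then show "?A k \<subseteq> ?A (Suc k)" by (intro Collect_mono) linarith
    qed
    show "emeasure lebesgue (\<Union>k. ?A k) \<noteq> \<infinity>"
      unfolding U infinity_ennreal_def by (rule fmeasurableD2[OF meas])
  qed
  then have "\<forall>\<^sub>F k in sequentially. s < measure lebesgue (?A k)"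
    using assms(3) unfolding U distribution_function_def by (rule order_tendstoD)
  then obtain k where "s < measure lebesgue (?A k)"
    by (auto simp: eventually_sequentially)
  then show ?thesis
    by (intro exI[of _ "\<alpha> + 1 / real (Suc k)"]) (simp add: distribution_function_def)
qed

lemma distribution_function_tail:
  fixes f :: "'a::euclidean_space \<Rightarrow> real"
  assumes "set_integrable lebesgue S f" "S \<in> lmeasurable" "0 < s"
  shows "\<exists>\<alpha>\<ge>0. distribution_function S f \<alpha> \<le> s"
proof -
  define I where "I = (LINT x:S|lebesgue. \<bar>f x\<bar>)"
  have I: "measure lebesgue {x\<in>S. \<alpha> < \<bar>f x\<bar>} * \<alpha> \<le> I" for \<alpha>
    unfolding I_def
    using superlevel_abs_lmeasurable[OF assms(1,2)] assms(2)
    by (intro set_integral_const_le set_integrable_abs assms) (auto simp: fmeasurableD)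
  have "0 \<le> I" using I[of 0] by simp
  \<comment> \<open>Chebyshev's inequality asks for \<open>I \<le> s * \<alpha>\<close>; the summand
    1 keeps \<alpha> positive when \<open>I = 0\<close>, so that it can be cancelled.\<close>
  define \<alpha> where "\<alpha> = I / s + 1"
  have \<alpha>: "0 < \<alpha>" "I \<le> s * \<alpha>" using \<open>0 \<le> I\<close> \<open>0 < s\<close>
    by (auto simp: \<alpha>_def distrib_left add_nonneg_pos)
  then have "distribution_function S f \<alpha> * \<alpha> \<le> s * \<alpha>"
    using I[of \<alpha>] \<alpha>(2) unfolding distribution_function_def by linarith
  then have "distribution_function S f \<alpha> \<le> s" using \<alpha>(1) by (rule mult_right_le_imp_le)
  then show ?thesis using \<alpha> by (intro exI[of _ \<alpha>]) auto
qed

text \<open>The set is downward closed by monotonicity, bounded by the tail estimate, and has no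
  maximum by right-continuity. It is therefore a half-open interval starting at 0, whose length is
  the rearrangement by definition.\<close>

lemma decreasing_rearrangement_level:
  fixes f :: "'a::euclidean_space \<Rightarrow> real"
  assumes "set_integrable lebesgue S f" "S \<in> lmeasurable" "0 < s"
  shows "{\<alpha>. 0 \<le> \<alpha> \<and> distribution_function S f \<alpha> > s} = {0..<decreasing_rearrangement S f s}"
proof -
  define T where "T = {\<alpha>. 0 \<le> \<alpha> \<and> distribution_function S f \<alpha> > s}"
  obtain b where b: "0 \<le> b" "distribution_function S f b \<le> s"
    using distribution_function_tail[OF assms] by blast
  have down: "\<beta> \<in> T" if "\<alpha> \<in> T" "0 \<le> \<beta>" "\<beta> \<le> \<alpha>" for \<alpha> \<beta>
    using that distribution_function_antimono[OF assms(1,2) that(3)] by (auto simp: T_def)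
  have bd: "\<alpha> < b" if "\<alpha> \<in> T" for \<alpha>
    using down[OF that b(1)] b(2) by (fastforce simp: T_def)
  have "\<exists>t\<ge>0. T = {0..<t}"
  proof (cases "T = {}")
    case True
    then show ?thesis by (intro exI[of _ 0]) auto
  next
    case False
    have bdd: "bdd_above T" using bd by (intro bdd_aboveI[of _ b]) (auto intro: less_imp_le)
    obtain \<alpha>0 where "\<alpha>0 \<in> T" using False by blast
    then have "0 \<le> Sup T" using cSup_upper[OF _ bdd, of \<alpha>0] by (auto simp: T_def)
    have lt: "\<alpha> < Sup T" if "\<alpha> \<in> T" for \<alpha>
    proof -
      obtain \<beta> where "\<alpha> < \<beta>" "s < distribution_function S f \<beta>"
        using distribution_function_gt_right[OF assms(1,2), of s \<alpha>] \<open>\<alpha> \<in> T\<close> by (auto simp: T_def)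
      then have "\<beta> \<in> T" using that by (auto simp: T_def)
      with \<open>\<alpha> < \<beta>\<close> show ?thesis using cSup_upper[OF _ bdd, of \<beta>] by auto
    qed
    have "T = {0..<Sup T}"
    proof (intro set_eqI iffI)
      fix \<alpha> assume "\<alpha> \<in> {0..<Sup T}"
      then show "\<alpha> \<in> T" using less_cSupD[OF False, of \<alpha>] down by (auto intro: less_imp_le)
    qed (use lt in \<open>auto simp: T_def\<close>)
    then show ?thesis using \<open>0 \<le> Sup T\<close> by blast
  qed
  then obtain t where t: "0 \<le> t" "T = {0..<t}" by blast
  then have "decreasing_rearrangement S f s = t"
    unfolding decreasing_rearrangement_def T_def[symmetric] by (simp add: measure_completion)
  then show ?thesis using t unfolding T_def by simp
qed

text \<open>The rearrangement as generalized inverse of the distribution function; monotonicity,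
  level sets and continuity are all derived from this equivalence.\<close>

lemma less_decreasing_rearrangement_iff:
  fixes f :: "'a::euclidean_space \<Rightarrow> real"
  assumes "set_integrable lebesgue S f" "S \<in> lmeasurable" "0 < s" "0 \<le> \<alpha>"
  shows "\<alpha> < decreasing_rearrangement S f s \<longleftrightarrow> s < distribution_function S f \<alpha>"
  using decreasing_rearrangement_level[OF assms(1-3)] assms(4) by (auto simp: set_eq_iff)

lemma decreasing_rearrangement_nonneg: "0 \<le> decreasing_rearrangement S f s"
  by (simp add: decreasing_rearrangement_def)

lemma decreasing_rearrangement_antimono:
  fixes f :: "'a::euclidean_space \<Rightarrow> real"
  assumes "set_integrable lebesgue S f" "S \<in> lmeasurable" "0 < s" "s \<le> t"
  shows "decreasing_rearrangement S f t \<le> decreasing_rearrangement S f s"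
proof (rule ccontr)
  let ?F = "decreasing_rearrangement S f"
  assume "\<not> ?thesis"
  then have "t < distribution_function S f (?F s)"
    using less_decreasing_rearrangement_iff[OF assms(1,2), of t "?F s"] assms(3,4)
      decreasing_rearrangement_nonneg[of S f s] by simp
  then show False
    using less_decreasing_rearrangement_iff[OF assms(1-3), of "?F s"] assms(4)
      decreasing_rearrangement_nonneg[of S f s] by simp
qed

lemma decreasing_rearrangement_superlevel:
  fixes f :: "'a::euclidean_space \<Rightarrow> real"
  assumes "set_integrable lebesgue S f" "S \<in> lmeasurable"
  shows "{s\<in>{0<..<measure lebesgue S}. \<alpha> < decreasing_rearrangement S f s} = {0<..<distribution_function S f \<alpha>}"
proof (cases "0 \<le> \<alpha>")
  case True
  then show ?thesis
    using less_decreasing_rearrangement_iff[OF assms] distribution_function_le_measure[OF assms, of \<alpha>]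
    by auto
next
  \<comment> \<open>Negative levels are included because equimeasurability is tested on all rays;
    here both sides are the whole interval.\<close>
  case False
  then have "\<alpha> < decreasing_rearrangement S f s" for s
    using decreasing_rearrangement_nonneg[of S f s] by linarith
  moreover have "{x\<in>S. \<alpha> < \<bar>f x\<bar>} = S" using False by (auto intro: less_le_trans[OF _ abs_ge_zero])
  ultimately show ?thesis by (auto simp: distribution_function_def)
qed

lemma borel_measurable_decreasing_rearrangement:
  fixes f :: "'a::euclidean_space \<Rightarrow> real"
  assumes "set_integrable lebesgue S f" "S \<in> lmeasurable"
  shows "decreasing_rearrangement S f \<in> borel_measurable (lebesgue_on {0<..<measure lebesgue S})"
proof (rule borel_measurableI_greater)
  fix \<alpha>
  have "{s\<in>space (lebesgue_on {0<..<measure lebesgue S}). \<alpha> < decreasing_rearrangement S f s} = {0<..<distribution_function S f \<alpha>}"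
    using decreasing_rearrangement_superlevel[OF assms, of \<alpha>] by simp
  moreover have "{0<..<distribution_function S f \<alpha>} \<subseteq> {0<..<measure lebesgue S}"
    using distribution_function_le_measure[OF assms, of \<alpha>] by auto
  ultimately show "{s\<in>space (lebesgue_on {0<..<measure lebesgue S}). \<alpha> < decreasing_rearrangement S f s} \<in>
      sets (lebesgue_on {0<..<measure lebesgue S})"
    by (simp add: sets_restrict_space_iff)
qed

text \<open>Both push-forwards give each ray above \<alpha> the value of the distribution function
  at \<alpha>. The rays are closed under intersection, generate the Borel sets and exhaust the line
  with finite mass, so the measures coincide.\<close>

lemma decreasing_rearrangement_equimeasurable:
  fixes f :: "'a::euclidean_space \<Rightarrow> real"
  assumes int: "set_integrable lebesgue S f" and S: "S \<in> lmeasurable"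
  shows "distr (lebesgue_on {0<..<measure lebesgue S}) borel (decreasing_rearrangement S f)
    = distr (lebesgue_on S) borel (\<lambda>x. \<bar>f x\<bar>)"
    and "(\<lambda>x. \<bar>f x\<bar>) \<in> borel_measurable (lebesgue_on S)"
proof -
  let ?J = "{0<..<measure lebesgue S}" and ?F = "decreasing_rearrangement S f"
  have F: "?F \<in> borel_measurable (lebesgue_on ?J)"
    by (rule borel_measurable_decreasing_rearrangement) fact+
  have "(\<lambda>x. indicator S x *\<^sub>R \<bar>f x\<bar>) \<in> borel_measurable lebesgue"
    using set_integrable_abs[OF int] unfolding set_integrable_def by blast
  then show u: "(\<lambda>x. \<bar>f x\<bar>) \<in> borel_measurable (lebesgue_on S)"
    using S by (subst borel_measurable_restrict_space_iff) (auto simp: fmeasurableD)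
  have eq: "emeasure (distr (lebesgue_on ?J) borel ?F) {\<alpha><..} = ennreal (distribution_function S f \<alpha>)"
    "emeasure (distr (lebesgue_on S) borel (\<lambda>x. \<bar>f x\<bar>)) {\<alpha><..} = ennreal (distribution_function S f \<alpha>)" for \<alpha>
  proof -
    have "?F -` {\<alpha><..} \<inter> space (lebesgue_on ?J) = {s\<in>?J. \<alpha> < ?F s}" by auto
    then have "?F -` {\<alpha><..} \<inter> space (lebesgue_on ?J) = {0<..<distribution_function S f \<alpha>}"
      using decreasing_rearrangement_superlevel[OF assms, of \<alpha>] by simp
    moreover have "{0<..<distribution_function S f \<alpha>} \<subseteq> ?J"
      using distribution_function_le_measure[OF assms, of \<alpha>] by auto
    ultimately show "emeasure (distr (lebesgue_on ?J) borel ?F) {\<alpha><..} = ennreal (distribution_function S f \<alpha>)"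
      using F by (simp add: emeasure_distr emeasure_restrict_space distribution_function_def)
    have "(\<lambda>x. \<bar>f x\<bar>) -` {\<alpha><..} \<inter> space (lebesgue_on S) = {x\<in>S. \<alpha> < \<bar>f x\<bar>}" by auto
    then show "emeasure (distr (lebesgue_on S) borel (\<lambda>x. \<bar>f x\<bar>)) {\<alpha><..} = ennreal (distribution_function S f \<alpha>)"
      using u S superlevel_abs_lmeasurable[OF assms, of \<alpha>]
      by (simp add: emeasure_distr emeasure_restrict_space fmeasurableD distribution_function_def emeasure_eq_measure2)
  qed
  show "distr (lebesgue_on ?J) borel ?F = distr (lebesgue_on S) borel (\<lambda>x. \<bar>f x\<bar>)"
  proof (rule measure_eqI_generator_eq)
    show "Int_stable (range (greaterThan :: real \<Rightarrow> real set))"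
    proof -
      have "{a<..} \<inter> {b<..} = {max a b<..}" for a b :: real by auto
      then show ?thesis by (auto simp: Int_stable_def)
    qed
    have "sets (borel :: real measure) = sigma_sets UNIV (range greaterThan)"
      by (subst borel_Ioi) simp
    then show "sets (distr (lebesgue_on ?J) borel ?F) = sigma_sets UNIV (range greaterThan)"
      "sets (distr (lebesgue_on S) borel (\<lambda>x. \<bar>f x\<bar>)) = sigma_sets UNIV (range greaterThan)"
      by simp_all
    show "range (\<lambda>i::nat. {- real i<..}) \<subseteq> range greaterThan" by auto
    show "(\<Union>i::nat. {- real i<..}) = UNIV"
    proof -
      have "\<exists>i::nat. - real i < x" for x using reals_Archimedean2[of "- x"] by (auto simp: minus_less_iff)
      then show ?thesis by auto
    qed
  qed (auto simp: eq)
qed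

text \<open>Both integrals are integrals of \<open>h\<close> against the common image measure. Later
  \<open>h\<close> is the identity or the excess over a level.\<close>

lemma decreasing_rearrangement_integral:
  fixes f :: "'a::euclidean_space \<Rightarrow> real" and h :: "real \<Rightarrow> real"
  assumes int: "set_integrable lebesgue S f" and S: "S \<in> lmeasurable" and h: "h \<in> borel_measurable borel"
  shows "(LINT s:{0<..<measure lebesgue S}|lebesgue. h (decreasing_rearrangement S f s)) = (LINT x:S|lebesgue. h \<bar>f x\<bar>)"
    and "set_integrable lebesgue {0<..<measure lebesgue S} (\<lambda>s. h (decreasing_rearrangement S f s)) \<longleftrightarrow>
      set_integrable lebesgue S (\<lambda>x. h \<bar>f x\<bar>)"
proof -
  note eq = decreasing_rearrangement_equimeasurable[OF int S]
  note F = borel_measurable_decreasing_rearrangement[OF int S]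
  have S': "S \<in> sets lebesgue" using S by (simp add: fmeasurableD)
  show "(LINT s:{0<..<measure lebesgue S}|lebesgue. h (decreasing_rearrangement S f s)) = (LINT x:S|lebesgue. h \<bar>f x\<bar>)"
    using integral_distr[OF F h] integral_distr[OF eq(2) h] eq(1) S'
    by (simp add: set_lebesgue_integral_def integral_restrict_space)
  show "set_integrable lebesgue {0<..<measure lebesgue S} (\<lambda>s. h (decreasing_rearrangement S f s)) \<longleftrightarrow>
      set_integrable lebesgue S (\<lambda>x. h \<bar>f x\<bar>)"
    using integrable_distr_eq[OF F h] integrable_distr_eq[OF eq(2) h] eq(1) S'
    by (simp add: set_integrable_def integrable_restrict_space)
qed

text \<open>A jump to the left of \<open>s\<close> would keep the distribution function constant,
  equal to \<open>s\<close>, over an interval of levels, which \<open>no_gap\<close> forbids.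
  Right-continuity comes from the strict inequality in the generalized inverse.\<close>

lemma continuous_on_decreasing_rearrangement:
  fixes f :: "'a::euclidean_space \<Rightarrow> real"
  assumes int: "set_integrable lebesgue S f" and S: "S \<in> lmeasurable"
    and no_gap: "\<And>\<alpha> \<beta>. 0 \<le> \<alpha> \<Longrightarrow> \<alpha> < \<beta> \<Longrightarrow> distribution_function S f \<beta> = distribution_function S f \<alpha> \<Longrightarrow>
      distribution_function S f \<alpha> = 0 \<or> distribution_function S f \<alpha> = measure lebesgue S"
  shows "continuous_on {0<..<measure lebesgue S} (decreasing_rearrangement S f)"
proof (rule continuous_at_imp_continuous_on, rule ballI)
  let ?F = "decreasing_rearrangement S f" and ?\<mu> = "distribution_function S f" and ?M = "measure lebesgue S"
  note iff = less_decreasing_rearrangement_iff[OF int S]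
  note anti = decreasing_rearrangement_antimono[OF int S]
  note nonneg = decreasing_rearrangement_nonneg[of S f]
  fix s assume s: "s \<in> {0<..<?M}"
  have left: "\<exists>s1. 0 < s1 \<and> s1 < s \<and> ?F s1 < ?F s + e" if "0 < e" for e
  proof -
    have le: "?\<mu> (?F s) \<le> s" using iff[of s "?F s"] s nonneg[of s] by auto
    \<comment> \<open>Any positive \<open>s1\<close> between these two numbers satisfies
      \<open>?F s1 \<le> ?F s + e/2\<close>. If the value at \<open>?F s\<close> is 0, positivity of
      \<open>s\<close> suffices; otherwise \<open>no_gap\<close> gives a strict drop.\<close>
    have "?\<mu> (?F s + e/2) < s"
    proof (cases "?\<mu> (?F s) = 0")
      case True
      then have "?\<mu> (?F s + e/2) \<le> 0"
        using distribution_function_antimono[OF int S, of "?F s" "?F s + e/2"] that by simp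
      then show ?thesis using s by simp
    next
      case False
      then have "?\<mu> (?F s + e/2) \<noteq> ?\<mu> (?F s)"
        using no_gap[of "?F s" "?F s + e/2"] le s nonneg[of s] that by auto
      moreover have "?\<mu> (?F s + e/2) \<le> ?\<mu> (?F s)"
        using distribution_function_antimono[OF int S, of "?F s" "?F s + e/2"] that by simp
      ultimately show ?thesis using le by simp
    qed
    then have "max 0 (?\<mu> (?F s + e/2)) < s" using s by simp
    then obtain s1 where s1: "max 0 (?\<mu> (?F s + e/2)) < s1" "s1 < s" using dense by blast
    then have "\<not> ?F s + e/2 < ?F s1" using iff[of s1 "?F s + e/2"] nonneg[of s] that by simp
    then show ?thesis using s1 that by (intro exI[of _ s1]) simp
  qed
  have right: "\<exists>s2. s < s2 \<and> ?F s - e < ?F s2" if "0 < e" for e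
  proof (cases "?F s - e/2 < 0")
    case True
    then show ?thesis using nonneg[of "s + 1"] that by (intro exI[of _ "s+1"]) auto
  next
    case False
    then have "s < ?\<mu> (?F s - e/2)" using iff[of s "?F s - e/2"] s that by simp
    then obtain s2 where s2: "s < s2" "s2 < ?\<mu> (?F s - e/2)" using dense by blast
    then have "?F s - e/2 < ?F s2" using iff[of s2 "?F s - e/2"] s False by simp
    then show ?thesis using s2 that by (intro exI[of _ s2]) simp
  qed
  show "isCont ?F s"
    unfolding continuous_at_eps_delta
  proof (intro allI impI)
    fix e :: real assume "0 < e"
    obtain s1 where s1: "0 < s1" "s1 < s" "?F s1 < ?F s + e" using left[OF \<open>0 < e\<close>] by blast
    obtain s2 where s2: "s < s2" "?F s - e < ?F s2" using right[OF \<open>0 < e\<close>] by blast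
    have "dist (?F x) (?F s) < e" if "dist x s < min (s - s1) (s2 - s)" for x
    proof -
      have x: "s1 < x" "x < s2" using that by (auto simp: dist_real_def abs_less_iff)
      then have "?F x \<le> ?F s1" "?F s2 \<le> ?F x" using s1 by (auto intro!: anti)
      then show ?thesis using s1 s2 by (auto simp: dist_real_def abs_less_iff)
    qed
    then show "\<exists>d>0. \<forall>x. dist x s < d \<longrightarrow> dist (?F x) (?F s) < e"
      using s1 s2 by (intro exI[of _ "min (s - s1) (s2 - s)"]) auto
  qed
qed

subsection \<open>Rearrangements of VMO functions\<close>

lemma VMO_I:
  fixes f :: "'a::euclidean_space \<Rightarrow> real"
  assumes "\<And>Q. is_cube Q \<Longrightarrow> Q \<subseteq> S \<Longrightarrow> set_integrable lebesgue Q f"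
    and "\<And>Q. is_cube Q \<Longrightarrow> Q \<subseteq> S \<Longrightarrow> mean_oscillation f Q \<le> B"
    and "\<And>e. 0 < e \<Longrightarrow> \<exists>\<delta>>0. \<forall>Q. is_cube Q \<longrightarrow> Q \<subseteq> S \<longrightarrow> measure lebesgue Q \<le> \<delta> \<longrightarrow> mean_oscillation f Q \<le> e"
  shows "f \<in> VMO S"
proof -
  have "BMO_norm S f \<le> ennreal B"
    unfolding BMO_norm_def using assms(2) by (intro SUP_least) (auto intro: ennreal_leI)
  then have "BMO_norm S f < \<infinity>" using ennreal_less_top le_less_trans by (metis infinity_ennreal_def)
  moreover have "(VMO_modulus S f \<longlongrightarrow> 0) (at_right 0)"
  proof (rule order_tendstoI)
    fix a :: ennreal assume "0 < a"
    \<comment> \<open>\<open>a\<close> may be infinite, so a finite level below it is chosen and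
      converted to a real.\<close>
    then obtain c where c: "0 < c" "c < a" using dense by blast
    then have "c < top" by (meson less_le_trans top_greatest)
    define e where "e = enn2real c"
    have e: "0 < e" "ennreal e < a" using c \<open>c < top\<close> by (auto simp: e_def enn2real_positive_iff)
    obtain \<delta> where \<delta>: "0 < \<delta>" "\<And>Q. is_cube Q \<Longrightarrow> Q \<subseteq> S \<Longrightarrow> measure lebesgue Q \<le> \<delta> \<Longrightarrow> mean_oscillation f Q \<le> e"
      using assms(3)[OF e(1)] by blast
    have "VMO_modulus S f d < a" if "d < \<delta>" for d
    proof -
      have "VMO_modulus S f d \<le> ennreal e"
        unfolding VMO_modulus_def using \<delta>(2) that by (intro SUP_least) (auto intro!: ennreal_leI)
      then show ?thesis using e(2) by (rule le_less_trans)
    qed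
    then show "\<forall>\<^sub>F d in at_right 0. VMO_modulus S f d < a"
      using \<delta>(1) unfolding eventually_at_right_field by blast
  qed simp
  ultimately show ?thesis using assms(1) by (auto simp: VMO_def BMO_def)
qed

lemma VMO_D:
  fixes f :: "'a::euclidean_space \<Rightarrow> real"
  assumes "f \<in> VMO S"
  shows "\<And>Q. is_cube Q \<Longrightarrow> Q \<subseteq> S \<Longrightarrow> set_integrable lebesgue Q f"
    and "\<And>e. 0 < e \<Longrightarrow> \<exists>\<delta>>0. \<forall>Q. is_cube Q \<longrightarrow> Q \<subseteq> S \<longrightarrow> measure lebesgue Q \<le> \<delta> \<longrightarrow> mean_oscillation f Q \<le> e"
proof -
  show "\<And>Q. is_cube Q \<Longrightarrow> Q \<subseteq> S \<Longrightarrow> set_integrable lebesgue Q f"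
    using assms by (auto simp: VMO_def BMO_def)
  fix e :: real assume "0 < e"
  have "(VMO_modulus S f \<longlongrightarrow> 0) (at_right 0)" using assms by (simp add: VMO_def)
  then have "\<forall>\<^sub>F d in at_right 0. VMO_modulus S f d < ennreal e"
    using \<open>0 < e\<close> by (auto intro: order_tendstoD)
  then obtain b where b: "0 < b" "\<And>d. 0 < d \<Longrightarrow> d < b \<Longrightarrow> VMO_modulus S f d < ennreal e"
    unfolding eventually_at_right_field by blast
  have "mean_oscillation f Q \<le> e" if "is_cube Q" "Q \<subseteq> S" "measure lebesgue Q \<le> b / 2" for Q
  proof -
    have "ennreal (mean_oscillation f Q) \<le> VMO_modulus S f (b / 2)"
      unfolding VMO_modulus_def using that by (intro SUP_upper) auto
    also have "\<dots> < ennreal e" using b by simp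
    finally show ?thesis using \<open>0 < e\<close> by (simp add: ennreal_less_iff mean_oscillation_nonneg)
  qed
  then show "\<exists>\<delta>>0. \<forall>Q. is_cube Q \<longrightarrow> Q \<subseteq> S \<longrightarrow> measure lebesgue Q \<le> \<delta> \<longrightarrow> mean_oscillation f Q \<le> e"
    using b(1) by (intro exI[of _ "b / 2"]) auto
qed

section \<open>Mean oscillation of decreasing functions on an interval\<close>

text \<open>If the interval has length at least \<open>q / 2\<close>, compare with the constant
  \<open>F q\<close>. Otherwise it lies in the right half of (0, q), where \<open>F\<close> varies
  by at most \<open>F (q / 2) - F q\<close>; the excess is at least this large on the left half, so
  its integral controls the variation. Both cases give the factor 4 / q.\<close>

lemma mean_oscillation_antimono_le:
  fixes F :: "real \<Rightarrow> real"
  assumes int: "set_integrable lebesgue {0<..<q} F" and anti: "\<And>s t. 0 < s \<Longrightarrow> s \<le> t \<Longrightarrow> t \<le> q \<Longrightarrow> F t \<le> F s"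
    and pq: "0 \<le> p" "p < q"
  shows "mean_oscillation F {p<..<q} \<le> 4 / q * (LINT s:{0<..<q}|lebesgue. max (F s - F q) 0)"
proof -
  define I where "I = (LINT s:{0<..<q}|lebesgue. max (F s - F q) 0)"
  have lm: "{0<..<q} \<in> lmeasurable" "{p<..<q} \<in> lmeasurable" using lebesgue_measurable_box(1)[of 0 q] lebesgue_measurable_box(1)[of p q] by (simp_all add: box_real)
  have meas: "measure lebesgue {x<..<y} = y - x" if "x \<le> y" for x y :: real
    using that by (simp add: measure_completion)
  have int': "set_integrable lebesgue {p<..<q} F"
    using pq by (intro set_integrable_subset[OF int]) auto
  have excess: "set_integrable lebesgue {0<..<q} (\<lambda>s. max (F s - F q) 0)"
    by (rule set_integrable_diff_const[OF int lm(1)])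
  have "0 \<le> I" unfolding I_def set_lebesgue_integral_def by (intro integral_nonneg_AE) auto
  show ?thesis
  proof (cases "p \<le> q / 2")
    case True
    have "mean_oscillation F {p<..<q} \<le> 2 / (q - p) * (LINT s:{p<..<q}|lebesgue. \<bar>F s - F q\<bar>)"
      using mean_oscillation_le[OF int' lm(2), of "F q"] pq by (simp add: meas)
    also have "\<dots> \<le> 2 / (q - p) * I"
    proof (intro mult_left_mono)
      have "(LINT s:{p<..<q}|lebesgue. \<bar>F s - F q\<bar>) = (LINT s:{p<..<q}|lebesgue. max (F s - F q) 0)"
        using pq anti[of _ q] by (intro set_lebesgue_integral_cong) (auto simp: max_def intro!: antisym)
      also have "\<dots> \<le> I" unfolding I_def
        using pq by (intro set_integral_nonneg_mono_set excess) auto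
      finally show "(LINT s:{p<..<q}|lebesgue. \<bar>F s - F q\<bar>) \<le> I" .
    qed (use pq in auto)
    also have "\<dots> \<le> 4 / q * I"
      using True pq \<open>0 \<le> I\<close> by (intro mult_right_mono) (auto simp: field_simps)
    finally show ?thesis by (simp add: I_def)
  next
    case False
    have "mean_oscillation F {p<..<q} \<le> 2 * (F (q / 2) - F q)"
      using pq False by (intro mean_oscillation_le_of_bounds int' lm) (auto simp: meas intro!: anti)
    also have "\<dots> = 4 / q * (measure lebesgue {0<..<q/2} * (F (q/2) - F q))"
      using pq by (simp add: meas)
    also have "\<dots> \<le> 4 / q * I"
      unfolding I_def using pq
      by (intro mult_left_mono set_integral_const_le excess lm) (auto simp: intro!: max.coboundedI1 anti)
    finally show ?thesis by (simp add: I_def)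
  qed
qed

text \<open>Continuity is given only on the open interval, but a decreasing function bounded below
  has a limit at \<open>M\<close>. Beyond some \<open>z\<close> the values stay within
  \<open>e\<close> of this limit, and before a slightly later \<open>w\<close> compactness gives
  uniform continuity.\<close>

lemma antimono_uniformly_close:
  fixes F :: "real \<Rightarrow> real"
  assumes cont: "continuous_on {0<..<M} F" and anti: "\<And>s t. 0 < s \<Longrightarrow> s \<le> t \<Longrightarrow> t < M \<Longrightarrow> F t \<le> F s"
    and nonneg: "\<And>s. 0 \<le> F s" and p: "0 < p" "p < M" and e: "0 < e"
  shows "\<exists>\<delta>>0. \<forall>x y. p \<le> x \<longrightarrow> x \<le> y \<longrightarrow> y < M \<longrightarrow> y - x \<le> \<delta> \<longrightarrow> F x - F y \<le> e"
proof -
  define L where "L = Inf (F ` {p..<M})"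
  have bdd: "bdd_below (F ` {p..<M})" using nonneg by (intro bdd_belowI[of _ 0]) auto
  have ne: "F ` {p..<M} \<noteq> {}" using p by auto
  have "Inf (F ` {p..<M}) < L + e" using e by (simp add: L_def)
  then obtain y where "y \<in> F ` {p..<M}" "y < L + e"
    using cInf_lessD[OF ne, of "L + e"] by blast
  then obtain z where z: "p \<le> z" "z < M" "F z < L + e" by auto
  have L: "L \<le> F x" if "p \<le> x" "x < M" for x
    unfolding L_def using that bdd by (intro cInf_lower) auto
  define w where "w = (z + M) / 2"
  have w: "z < w" "w < M" using z by (auto simp: w_def)
  have "uniformly_continuous_on {p..w} F"
    using p w by (intro compact_uniformly_continuous continuous_on_subset[OF cont]) auto
  then obtain d where d: "0 < d" "\<And>x y. x \<in> {p..w} \<Longrightarrow> y \<in> {p..w} \<Longrightarrow> dist y x < d \<Longrightarrow> dist (F y) (F x) < e"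
    using e unfolding uniformly_continuous_on_def by metis
  \<comment> \<open>The overlap \<open>w - z\<close> ensures that a pair not contained in
    \<open>{p..w}\<close> lies entirely beyond \<open>z\<close>.\<close>
  define \<delta> where "\<delta> = min (d / 2) (w - z)"
  have "F x - F y \<le> e" if xy: "p \<le> x" "x \<le> y" "y < M" "y - x \<le> \<delta>" for x y
  proof (cases "y \<le> w")
    case True
    then have "dist (F y) (F x) < e" using xy d(1) by (intro d(2)) (auto simp: dist_real_def \<delta>_def)
    then show ?thesis by (simp add: dist_real_def abs_less_iff)
  next
    case False
    then have "z \<le> x" using xy by (auto simp: \<delta>_def)
    then have "F x \<le> F z" using xy p z by (intro anti) auto
    then show ?thesis using L[of y] xy z by linarith
  qed
  moreover have "0 < \<delta>" using d w by (auto simp: \<delta>_def)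
  ultimately show ?thesis by blast
qed

text \<open>Intervals near 0 are controlled by the excess hypothesis, all others by boundedness and
  uniform continuity of \<open>F\<close> away from 0.\<close>

lemma antimono_in_VMO:
  fixes F :: "real \<Rightarrow> real"
  assumes "0 < M" and int: "set_integrable lebesgue {0<..<M} F" and cont: "continuous_on {0<..<M} F"
    and anti: "\<And>s t. 0 < s \<Longrightarrow> s \<le> t \<Longrightarrow> t < M \<Longrightarrow> F t \<le> F s" and nonneg: "\<And>s. 0 \<le> F s"
    and excess: "\<And>e. 0 < e \<Longrightarrow> \<exists>\<eta>>0. \<forall>q. 0 < q \<longrightarrow> q \<le> \<eta> \<longrightarrow> q < M \<longrightarrow>
        (LINT s:{0<..<M}|lebesgue. max (F s - F q) 0) \<le> e * q"
  shows "F \<in> VMO {0<..<M}"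
proof -
  have lm: "{p<..<q} \<in> lmeasurable" for p q :: real using lebesgue_measurable_box(1)[of p q] by (simp add: box_real)
  have meas: "measure lebesgue {x<..<y} = y - x" if "x \<le> y" for x y :: real
    using that by (simp add: measure_completion)
  have sub: "set_integrable lebesgue {p<..<q} F" if "0 \<le> p" "q \<le> M" for p q
    using that by (intro set_integrable_subset[OF int]) auto
  have interval: "\<exists>p q. 0 \<le> p \<and> p < q \<and> q \<le> M \<and> Q = {p<..<q}" if "is_cube Q" "Q \<subseteq> {0<..<M}" for Q
  proof -
    obtain p q where "p < q" "Q = {p<..<q}" using \<open>is_cube Q\<close> by (auto simp: is_cube_real)
    moreover then have "0 \<le> p" "q \<le> M"
      using \<open>Q \<subseteq> {0<..<M}\<close> by (auto simp: greaterThanLessThan_subseteq_greaterThanLessThan)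
    ultimately show ?thesis by blast
  qed
  have near: "\<exists>\<eta>>0. \<eta> < M \<and> (\<forall>p q. 0 \<le> p \<longrightarrow> p < q \<longrightarrow> q \<le> \<eta> \<longrightarrow> mean_oscillation F {p<..<q} \<le> e)" if e: "0 < e" for e
  proof -
    obtain \<eta> where \<eta>: "0 < \<eta>" "\<And>q. 0 < q \<Longrightarrow> q \<le> \<eta> \<Longrightarrow> q < M \<Longrightarrow> (LINT s:{0<..<M}|lebesgue. max (F s - F q) 0) \<le> e / 4 * q"
      using excess[of "e/4"] e by (metis divide_pos_pos zero_less_numeral)
    \<comment> \<open>Capping by \<open>M / 2\<close> keeps \<open>q\<close> below \<open>M\<close>,
      where monotonicity is available; \<open>e / 4 * q\<close> cancels the factor 4 / q.\<close>
    have "mean_oscillation F {p<..<q} \<le> e" if pq: "0 \<le> p" "p < q" "q \<le> min \<eta> (M / 2)" for p q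
    proof -
      have qM: "q < M" using pq \<open>0 < M\<close> by auto
      have "(LINT s:{0<..<q}|lebesgue. max (F s - F q) 0) \<le> (LINT s:{0<..<M}|lebesgue. max (F s - F q) 0)"
        using qM by (intro set_integral_nonneg_mono_set set_integrable_diff_const int lm) auto
      also have "\<dots> \<le> e / 4 * q" using \<eta>(2) pq qM by auto
      finally have "4 / q * (LINT s:{0<..<q}|lebesgue. max (F s - F q) 0) \<le> 4 / q * (e / 4 * q)"
        using pq by (intro mult_left_mono) auto
      also have "\<dots> = e" using pq by simp
      finally show ?thesis
        using mean_oscillation_antimono_le[of q F p] sub[of 0 q] anti pq qM by force
    qed
    then show ?thesis using \<eta>(1) \<open>0 < M\<close> by (intro exI[of _ "min \<eta> (M/2)"]) auto
  qed
  obtain \<eta> where \<eta>: "0 < \<eta>" "\<eta> < M" "\<And>p q. 0 \<le> p \<Longrightarrow> p < q \<Longrightarrow> q \<le> \<eta> \<Longrightarrow> mean_oscillation F {p<..<q} \<le> 1"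
    using near[of 1] by auto
  define I where "I = (LINT s:{0<..<M}|lebesgue. \<bar>F s - 0\<bar>)"
  have "0 \<le> I" unfolding I_def set_lebesgue_integral_def by (intro integral_nonneg_AE) auto
  show ?thesis
  proof (rule VMO_I)
    fix Q assume Q: "is_cube Q" "Q \<subseteq> {0<..<M}"
    then obtain p q where pq: "0 \<le> p" "p < q" "q \<le> M" "Q = {p<..<q}" using interval by blast
    show "set_integrable lebesgue Q F" using pq sub by simp
    show "mean_oscillation F Q \<le> max 1 (max (2 * F (\<eta>/2)) (4 / \<eta> * I))"
    proof -
      \<comment> \<open>The interval lies near 0, or lies where \<open>F\<close> is at most
        \<open>F (\<eta>/2)\<close>, or has length above \<open>\<eta> / 2\<close> and is controlled
        by the integral of |F|.\<close>
      consider "q \<le> \<eta>" | "\<eta> < q" "\<eta> / 2 \<le> p" | "\<eta> < q" "p < \<eta> / 2" by linarith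
      then show ?thesis
      proof cases
        case 1
        then show ?thesis using \<eta>(3) pq by (auto intro!: max.coboundedI1)
      next
        case 2
        have "mean_oscillation F {p<..<q} \<le> 2 * (F (\<eta>/2) - 0)"
          using pq 2 \<eta> by (intro mean_oscillation_le_of_bounds sub lm) (auto simp: meas nonneg intro!: anti)
        then show ?thesis using pq by auto
      next
        case 3
        have "mean_oscillation F {p<..<q} \<le> 2 / (q - p) * (LINT s:{p<..<q}|lebesgue. \<bar>F s - 0\<bar>)"
          using mean_oscillation_le[OF sub lm, of p q 0] pq by (simp add: meas)
        also have "\<dots> \<le> 2 / (q - p) * I"
          unfolding I_def using pq
          by (intro mult_left_mono set_integral_nonneg_mono_set set_integrable_diff_const int lm) auto
        also have "\<dots> \<le> 4 / \<eta> * I"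
          using 3 \<eta> \<open>0 \<le> I\<close> by (intro mult_right_mono) (auto simp: field_simps)
        finally show ?thesis using pq by auto
      qed
    qed
  next
    fix e :: real assume "0 < e"
    obtain \<eta> where \<eta>: "0 < \<eta>" "\<eta> < M" "\<And>p q. 0 \<le> p \<Longrightarrow> p < q \<Longrightarrow> q \<le> \<eta> \<Longrightarrow> mean_oscillation F {p<..<q} \<le> e"
      using near[OF \<open>0 < e\<close>] by auto
    obtain \<delta> where \<delta>: "0 < \<delta>" "\<And>x y. \<eta> / 2 \<le> x \<Longrightarrow> x \<le> y \<Longrightarrow> y < M \<Longrightarrow> y - x \<le> \<delta> \<Longrightarrow> F x - F y \<le> e / 4"
      using antimono_uniformly_close[OF cont anti nonneg, of "\<eta>/2" "e/4"] \<eta> \<open>0 < e\<close> by auto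
    have "mean_oscillation F Q \<le> e" if Q: "is_cube Q" "Q \<subseteq> {0<..<M}" "measure lebesgue Q \<le> min \<delta> (\<eta> / 2)" for Q
    proof -
      obtain p q where pq: "0 \<le> p" "p < q" "q \<le> M" "Q = {p<..<q}" using Q interval by blast
      then have len: "q - p \<le> \<delta>" "q - p \<le> \<eta> / 2" using Q(3) by (auto simp: meas)
      show ?thesis
      proof (cases "q \<le> \<eta>")
        case True
        then show ?thesis using \<eta>(3) pq by auto
      next
        case False
        \<comment> \<open>A short interval ending beyond \<eta> stays to the right of
          \<open>\<eta> / 2\<close>. The midpoint is the reference point because \<open>q\<close>
          may equal \<open>M\<close>, where \<open>F\<close> is not controlled.\<close>
        define c where "c = (p + q) / 2"
        have c: "p < c" "c < q" "\<eta> / 2 \<le> p" using pq len False by (auto simp: c_def)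
        have close: "\<bar>F x - F c\<bar> \<le> e / 4" if "x \<in> {p<..<q}" for x
        proof (cases "x \<le> c")
          case True
          then have "F c \<le> F x" using that c pq by (intro anti) auto
          moreover have "F x - F c \<le> e / 4" using True that c pq len by (intro \<delta>(2)) auto
          ultimately show ?thesis by simp
        next
          case False
          then have "F x \<le> F c" using that c pq by (intro anti) auto
          moreover have "F c - F x \<le> e / 4" using False that c pq len by (intro \<delta>(2)) auto
          ultimately show ?thesis by simp
        qed
        have "mean_oscillation F {p<..<q} \<le> 2 * ((F c + e / 4) - (F c - e / 4))"
        proof (intro mean_oscillation_le_of_bounds sub lm)
          fix x assume "x \<in> {p<..<q}"
          from close[OF this] show "F c - e / 4 \<le> F x" "F x \<le> F c + e / 4" unfolding abs_le_iff by linarith+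
        qed (use pq in \<open>auto simp: meas\<close>)
        then show ?thesis using pq by simp
      qed
    qed
    then show "\<exists>\<delta>>0. \<forall>Q. is_cube Q \<longrightarrow> Q \<subseteq> {0<..<M} \<longrightarrow> measure lebesgue Q \<le> \<delta> \<longrightarrow> mean_oscillation F Q \<le> e"
      using \<delta>(1) \<eta>(1) by (intro exI[of _ "min \<delta> (\<eta>/2)"]) auto
  qed
qed

text \<open>Vanishing oscillation passes to g = |f|. The absence of gaps gives continuity of the
  rearrangement, and equimeasurability transfers the excess bound from the cube to the
  interval.\<close>

lemma decreasing_rearrangement_in_VMO:
  fixes Q :: "'a::euclidean_space set"
  assumes Q: "is_cube Q" and f: "f \<in> VMO Q"
  shows "decreasing_rearrangement Q f \<in> VMO {0<..<measure lebesgue Q}"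
proof -
  let ?n = "DIM('a)" and ?F = "decreasing_rearrangement Q f" and ?M = "measure lebesgue Q"
  define g where "g x = \<bar>f x\<bar>" for x
  obtain a R where aR: "0 < R" "Q = box a (a + R *\<^sub>R One)" using Q by (auto simp: is_cube_def)
  have lm: "Q \<in> lmeasurable" and M: "?M = R ^ ?n" "0 < ?M" using aR by (auto simp: measure_cube)
  have int: "set_integrable lebesgue Q f" using VMO_D(1)[OF f Q] by simp
  then have gint: "set_integrable lebesgue Q g" unfolding g_def by (rule set_integrable_abs)
  have osc: "\<exists>\<delta>>0. \<forall>b r. 0 < r \<longrightarrow> r ^ ?n \<le> \<delta> \<longrightarrow> box b (b + r *\<^sub>R One) \<subseteq> Q \<longrightarrow>
      mean_oscillation g (box b (b + r *\<^sub>R One)) \<le> e" if e: "0 < e" for e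
  proof -
    obtain \<delta> where \<delta>: "0 < \<delta>" "\<And>D. is_cube D \<Longrightarrow> D \<subseteq> Q \<Longrightarrow> measure lebesgue D \<le> \<delta> \<Longrightarrow> mean_oscillation f D \<le> e / 2"
      using VMO_D(2)[OF f half_gt_zero[OF e]] by blast
    have "mean_oscillation g D \<le> e" if D: "0 < r" "r ^ ?n \<le> \<delta>" "D \<subseteq> Q" "D = box b (b + r *\<^sub>R One)" for D b r
    proof -
      have "is_cube D" using D by (auto simp: is_cube_def)
      then have "mean_oscillation g D \<le> 2 * mean_oscillation f D"
        unfolding g_def using D VMO_D(1)[OF f] by (intro mean_oscillation_abs) (auto simp: measure_cube)
      also have "\<dots> \<le> 2 * (e / 2)" using \<delta>(2)[OF \<open>is_cube D\<close>] D by (simp add: measure_cube)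
      finally show ?thesis by simp
    qed
    then show ?thesis using \<delta>(1) by blast
  qed
  have dist: "distribution_function Q f \<alpha> = measure lebesgue {x\<in>Q. \<alpha> < g x}" for \<alpha>
    by (simp add: distribution_function_def g_def)
  show ?thesis
  proof (rule antimono_in_VMO)
    show "set_integrable lebesgue {0<..<?M} ?F"
      using decreasing_rearrangement_integral(2)[OF int lm, of "\<lambda>x. x"] gint by (simp add: g_def[abs_def])
    show "continuous_on {0<..<?M} ?F"
    proof (rule continuous_on_decreasing_rearrangement[OF int lm])
      fix \<alpha> \<beta> :: real
      assume "\<alpha> < \<beta>" "distribution_function Q f \<beta> = distribution_function Q f \<alpha>"
      then show "distribution_function Q f \<alpha> = 0 \<or> distribution_function Q f \<alpha> = ?M"
        using vanishing_oscillation_no_gap[of R a g \<alpha> \<beta>] gint osc aR unfolding dist by metis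
    qed
    fix e :: real assume "0 < e"
    \<comment> \<open>Chosen to cancel the constant of the excess bound.\<close>
    define w where "w = e / (12 * 2 ^ ?n)"
    have w: "0 < w" using \<open>0 < e\<close> by (simp add: w_def)
    then obtain \<delta> where \<delta>: "0 < \<delta>" "\<And>b r. 0 < r \<Longrightarrow> r ^ ?n \<le> \<delta> \<Longrightarrow> box b (b + r *\<^sub>R One) \<subseteq> Q \<Longrightarrow>
      mean_oscillation g (box b (b + r *\<^sub>R One)) \<le> w"
      using osc by blast
    \<comment> \<open>The first term makes the level set fill at most a quarter of the cube; the
      second makes every cube tested in the excess bound have measure at most \<delta>.\<close>
    define \<eta> where "\<eta> = min (?M / 4) (\<delta> / (4 * 2 ^ ?n))"
    have "(LINT s:{0<..<?M}|lebesgue. max (?F s - ?F q) 0) \<le> e * q" if q: "0 < q" "q \<le> \<eta>" for q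
    proof -
      define v where "v = ?F q"
      define m where "m = measure lebesgue {x\<in>Q. v < g x}"
      \<comment> \<open>The generalized inverse relation at the level \<open>?F q\<close> itself:
        since \<open>?F q < ?F q\<close> fails, the distribution function there is at most
        \<open>q\<close>.\<close>
      have m: "m \<le> q" "0 \<le> m"
        using less_decreasing_rearrangement_iff[OF int lm q(1), of "?F q"] decreasing_rearrangement_nonneg[of Q f q]
        by (auto simp: m_def v_def dist)
      have "(LINT s:{0<..<?M}|lebesgue. max (?F s - v) 0) = (LINT x:Q|lebesgue. max (g x - v) 0)"
        using decreasing_rearrangement_integral(1)[OF int lm, of "\<lambda>x. max (x - v) 0"] by (simp add: g_def)
      also have "\<dots> \<le> 12 * 2 ^ ?n * w * m"
        unfolding m_def aR(2)
      proof (rule set_integral_excess_weak_bound)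
        show "measure lebesgue {x \<in> box a (a + R *\<^sub>R One). v < g x} \<le> R ^ ?n / 4"
          using m q M unfolding m_def aR(2)[symmetric] \<eta>_def by auto
        fix b r assume br: "0 < r" "box b (b + r *\<^sub>R One) \<subseteq> box a (a + R *\<^sub>R One)"
          "r ^ ?n \<le> 4 * 2 ^ ?n * measure lebesgue {x \<in> box a (a + R *\<^sub>R One). v < g x}"
        have "r ^ ?n \<le> 4 * 2 ^ ?n * m" using br unfolding m_def aR(2)[symmetric] by simp
        also have "\<dots> \<le> 4 * 2 ^ ?n * (\<delta> / (4 * 2 ^ ?n))"
          using m q by (intro mult_left_mono) (auto simp: \<eta>_def)
        also have "\<dots> = \<delta>" by simp
        finally show "mean_oscillation g (box b (b + r *\<^sub>R One)) \<le> w"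
          using br by (intro \<delta>(2)) (auto simp: aR(2))
      qed (use aR gint w in auto)
      also have "\<dots> = e * m" by (simp add: w_def)
      also have "\<dots> \<le> e * q" using m \<open>0 < e\<close> by simp
      finally show ?thesis by (simp add: v_def)
    qed
    moreover have "0 < \<eta>" using \<delta>(1) M by (simp add: \<eta>_def)
    ultimately show "\<exists>\<eta>>0. \<forall>q. 0 < q \<longrightarrow> q \<le> \<eta> \<longrightarrow> q < ?M \<longrightarrow>
        (LINT s:{0<..<?M}|lebesgue. max (?F s - ?F q) 0) \<le> e * q"
      by blast
  qed (use M decreasing_rearrangement_antimono[OF int lm] decreasing_rearrangement_nonneg in auto)
qed

theorem theorem1:
  fixes Q\<^sub>0 :: "(real ^ 'n) set" and f :: "real ^ 'n \<Rightarrow> real"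
  assumes "is_cube Q\<^sub>0"
    and "f \<in> VMO Q\<^sub>0"
  shows "decreasing_rearrangement Q\<^sub>0 f \<in> VMO {0<..<measure lebesgue Q\<^sub>0}"
  using assms by (rule decreasing_rearrangement_in_VMO)

end
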